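(* Let $K=\mathbb{Q}(\sqrt{D})$ with $D\geq 2$ a squarefree integer, let $\mathcal{O}$ be the ring of integers of $K$, and let $\mathcal{O}^+$ be the set of totally positive elements of $\mathcal{O}$. Let $\kappa=1$ if $D\equiv 1\pmod 4$ and $\kappa=2$ if $D\equiv 2,3\pmod 4$. Let $m$ be a positive integer. (a) If $m<\frac{\kappa\sqrt D}{4}$, then not all elements of $m\mathcal{O}^+$ are sums of (finitely many) squares of elements of $\mathcal{O}$. (b) If $m\geq \frac{D}{2}$, then all elements of $\kappa m\mathcal{O}^+$ are sums of five squares of elements of $\mathcal{O}$. (c) If $m$ is odd and $D\equiv 2,3\pmod 4$, then there exist elements of $m\mathcal{O}^+$ that are not sums of (any finite number of) squares of elements of $\mathcal{O}$.
   Context: An element $\alpha\in K$ is totally positive if $\sigma(\alpha)>0$ for every embedding $\sigma:K\hookrightarrow\mathbb{R}$ (that is, both $\alpha$ and its conjugate $\alpha'$ are positive). For a positive integer $n$, $n\mathcal{O}^+=\{n\alpha:\alpha\in\mathcal{O}^+\}$. The squares in a sum of five squares may include $0^2$. *)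

theory Defs
  imports Complex_Main
    "HOL-Computational_Algebra.Polynomial"
    "HOL-Computational_Algebra.Squarefree"
begin

definition quad_field :: "int \<Rightarrow> real set" where
  "quad_field D = {of_rat a + of_rat b * sqrt (of_int D) | a b. True}"

definition ring_of_integers :: "real set \<Rightarrow> real set" where
  "ring_of_integers K = {x \<in> K. algebraic_int x}"

(* Only the values of \<sigma> on K matter. A unital ring homomorphism out of a field is
   automatically injective. *)
definition real_embedding :: "real set \<Rightarrow> (real \<Rightarrow> real) \<Rightarrow> bool" where
  "real_embedding K \<sigma> \<longleftrightarrow> \<sigma> 1 = 1 \<and>
     (\<forall>x\<in>K. \<forall>y\<in>K. \<sigma> (x + y) = \<sigma> x + \<sigma> y \<and> \<sigma> (x * y) = \<sigma> x * \<sigma> y)"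

definition totally_positive :: "real set \<Rightarrow> real \<Rightarrow> bool" where
  "totally_positive K x \<longleftrightarrow> (\<forall>\<sigma>. real_embedding K \<sigma> \<longrightarrow> \<sigma> x > 0)"

definition totally_positive_integers :: "real set \<Rightarrow> real set" where
  "totally_positive_integers K = {x \<in> ring_of_integers K. totally_positive K x}"

definition dilate :: "nat \<Rightarrow> real set \<Rightarrow> real set" where
  "dilate n A = (\<lambda>x. of_nat n * x) ` A"

definition sum_of_n_squares :: "real set \<Rightarrow> nat \<Rightarrow> real \<Rightarrow> bool" where
  "sum_of_n_squares R n x \<longleftrightarrow>
     (\<exists>xs. length xs = n \<and> set xs \<subseteq> R \<and> x = (\<Sum>y\<leftarrow>xs. y\<^sup>2))"

definition sum_of_squares :: "real set \<Rightarrow> real \<Rightarrow> bool" where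
  "sum_of_squares R x \<longleftrightarrow> (\<exists>n. sum_of_n_squares R n x)"

(* Meant for squarefree D, where the second case is D = 2 or 3 modulo 4. *)
definition kappa :: "int \<Rightarrow> nat" where
  "kappa D = (if D mod 4 = 1 then 1 else 2)"

end

theory Submission
  imports Defs "HOL-Analysis.Analysis" "HOL-Number_Theory.Number_Theory"
begin

text \<open>Put \<open>s = sqrt D\<close>. An integer of the field is \<open>(p + q s) / 2\<close> with \<open>p\<close>, \<open>q\<close> of equal
  parity (\<open>D = 1\<close> modulo 4) or both even (otherwise), and its square adds \<open>(p^2 + D q^2) / 4\<close>
  to the rational part and \<open>p q / 2\<close> to the coefficient of \<open>s\<close>.

  Parts (a) and (c) only compare these coordinates. If the coefficient of \<open>s\<close> in \<open>m \<alpha>\<close>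
  is not zero, then some \<open>p q\<close> is not zero, so the rational part is at least a fixed multiple
  of \<open>1 + D\<close>; this is too much for small \<open>m\<close> when \<open>\<alpha>\<close> is chosen barely totally positive. If
  all \<open>p\<close>, \<open>q\<close> are even, then a sum of squares has an even coefficient of \<open>s\<close>, but \<open>m (D + s)\<close>
  with odd \<open>m\<close> has not.

  For part (b), let \<open>1, w\<close> be the integral basis and write
  \<open>\<kappa> m \<alpha> = A + 2 B w + C w^2\<close>. There is one degree of freedom, \<open>C\<close>, which is taken as close as
  possible to the maximum of \<open>A C - B^2\<close>; the hypothesis \<open>m \<ge> D / 2\<close> makes this value
  nonnegative. It remains to use a theorem of Mordell: every positive semidefinite form
  \<open>A X^2 + 2 B X Y + C Y^2\<close> with integers \<open>A\<close>, \<open>B\<close>, \<open>C\<close> is a sum of five squares of integral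
  linear forms (\<open>five_squares_binary\<close>), with \<open>X = 1\<close> and \<open>Y = w\<close>.

  The passage from rational to integral linear forms is geometry of numbers. Two
  vectors with rational coordinates and integral inner products lie in some self-dual lattice,
  obtained from the integer lattice by two neighbour steps (\<open>self_dual_neighbour\<close>). A
  self-dual lattice in dimension at most 5 has an orthonormal basis
  (\<open>self_dual_orthonormal_basis\<close>), because a form of Hermite's reduction argument produces a
  vector of squared length below 2. Coordinates in that basis are integers.

  Over the rationals, let \<open>d = A C - B^2 > 0\<close>. Quaternion multiplication turns the
  problem into writing \<open>A\<close> as a sum of four squares and \<open>d = A x^2 + p1^2 + p2^2 + p3^2\<close>,
  after replacing \<open>A\<close> by \<open>A d\<close> if necessary. A choice of \<open>x\<close> makes the numerator of
  \<open>d - A x^2\<close> congruent to 1 modulo 4, so everything rests on the fact that such a number \<open>n\<close>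
  is a sum of three squares.

  To write \<open>n\<close> as a sum of three squares, one looks for a positive number \<open>q\<close> such
  that \<open>-q\<close> is a square modulo \<open>n\<close> and \<open>-n\<close> is a unit square modulo \<open>q\<close>: then an explicit
  self-dual lattice of rank 3 contains a vector of squared length \<open>n\<close>. For squarefree \<open>n\<close> one
  can take the squarefree part of any \<open>k = -1\<close> modulo \<open>n\<close> for which the sum \<open>R k\<close> of the
  Jacobi symbols \<open>(-n / d)\<close> over the divisors \<open>d\<close> of \<open>k\<close> is positive. The existence of \<open>k\<close> is
  an elementary averaging argument (\<open>exists_positive_divisor_sum\<close>): with logarithmic weights
  of length \<open>K\<close>, the sum of \<open>R k\<close> over the residue class differs from the sum of all \<open>R k\<close>,
  each with the weight of \<open>n k\<close>, by only \<open>O(ln K)\<close>, while the latter has order at least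
  \<open>sqrt K\<close> since \<open>R\<close> is nonnegative and at least 1 at squares.\<close>

section \<open>Short vectors in lattices\<close>

lemma int_multiple_mem:
  fixes W :: "'a::real_vector set"
  assumes "0 \<in> W" and diff: "\<And>x y. x \<in> W \<Longrightarrow> y \<in> W \<Longrightarrow> x - y \<in> W" and "x \<in> W"
  shows "of_int c *\<^sub>R x \<in> W"
proof (induction c rule: int_induct[where k = 0])
  case base
  show ?case using assms by simp
next
  case (step1 i)
  have "0 - x \<in> W" using assms by blast
  then have "of_int i *\<^sub>R x - (0 - x) \<in> W" using step1 diff by blast
  then show ?case by (simp add: algebra_simps)
next
  case (step2 i)
  then show ?case using diff[OF step2(2) \<open>x \<in> W\<close>] by (simp add: algebra_simps)
qed

lemma exists_minimal_vector:
  fixes W :: "'a::real_inner set"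
  assumes "(M::int) > 0" and disc: "\<And>x. x \<in> W \<Longrightarrow> of_int M * (x \<bullet> x) \<in> \<int>"
    and "\<exists>x\<in>W. x \<noteq> 0"
  obtains b where "b \<in> W" "b \<noteq> 0" "\<And>x. x \<in> W \<Longrightarrow> x \<noteq> 0 \<Longrightarrow> b \<bullet> b \<le> x \<bullet> x"
proof -
  define f where "f x = nat \<lfloor>of_int M * (x \<bullet> x)\<rfloor>" for x :: 'a
  obtain b where b: "b \<in> W \<and> b \<noteq> 0" and least: "\<And>x. x \<in> W \<and> x \<noteq> 0 \<Longrightarrow> f b \<le> f x"
    using ex_has_least_nat[of "\<lambda>x. x \<in> W \<and> x \<noteq> 0" _ f] assms(3) by metis
  have f: "real (f x) = of_int M * (x \<bullet> x)" if "x \<in> W" for x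
    using disc[OF that] \<open>M > 0\<close> by (auto simp: f_def Ints_def)
  have "b \<bullet> b \<le> x \<bullet> x" if "x \<in> W" "x \<noteq> 0" for x
  proof -
    have "real (f b) \<le> real (f x)" using least that by simp
    then show ?thesis using f b that \<open>M > 0\<close> by simp
  qed
  with b that show ?thesis by blast
qed

text \<open>A lattice whose nonzero vectors are long has a short vector in its dual. This is
  Hermite's reduction: let \<open>b\<close> be a shortest vector and project orthogonally to \<open>b\<close>.
  Subtracting a multiple of \<open>b\<close> from a representative shows that the projected lattice has
  squared minimum at least 3/4 of that of the lattice itself, and its dual vectors are dual
  vectors of the lattice. Hence one factor 4/3 per dimension. The number \<open>M\<close> expresses
  discreteness; unlike integrality, a common denominator of the inner products survives the
  projection.\<close>
lemma short_dual_vector: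
  fixes W :: "'a::euclidean_space set"
  assumes "0 \<in> W" and "\<And>x y. x \<in> W \<Longrightarrow> y \<in> W \<Longrightarrow> x - y \<in> W"
    and "(M::int) > 0" and "\<And>x y. x \<in> W \<Longrightarrow> y \<in> W \<Longrightarrow> of_int M * (x \<bullet> y) \<in> \<int>"
    and "\<exists>x\<in>W. x \<noteq> 0" and "dim W \<le> Suc n"
    and "a > 0" and "\<And>x. x \<in> W \<Longrightarrow> x \<noteq> 0 \<Longrightarrow> a \<le> x \<bullet> x"
  shows "\<exists>y\<in>span W. y \<noteq> 0 \<and> (\<forall>x\<in>W. x \<bullet> y \<in> \<int>) \<and> y \<bullet> y \<le> (4/3) ^ n / a"
  using assms
proof (induction n arbitrary: W M a rule: less_induct)
  case (less n W M a)
  note W0 = less.prems(1) and Wdiff = less.prems(2) and M = less.prems(3) and disc = less.prems(4)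
    and nontriv = less.prems(5) and dimW = less.prems(6) and a = less.prems(7) and amin = less.prems(8)
  obtain b where b: "b \<in> W" "b \<noteq> 0" and bmin: "\<And>x. x \<in> W \<Longrightarrow> x \<noteq> 0 \<Longrightarrow> b \<bullet> b \<le> x \<bullet> x"
    using exists_minimal_vector[of M W] M disc nontriv by blast
  have bb: "b \<bullet> b > 0" using b by simp
  have a_le: "a \<le> b \<bullet> b" using amin b by blast
  define \<mu> where "\<mu> x = (x \<bullet> b) / (b \<bullet> b)" for x
  define \<pi> where "\<pi> x = x - \<mu> x *\<^sub>R b" for x
  have \<pi>b: "\<pi> x \<bullet> b = 0" for x
    using bb by (simp add: \<pi>_def \<mu>_def inner_diff_left)
  have \<pi>diff: "\<pi> x - \<pi> y = \<pi> (x - y)" for x y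
    by (simp add: \<pi>_def \<mu>_def algebra_simps inner_diff_left diff_divide_distrib)
  have \<pi>inner: "\<pi> x \<bullet> y = \<pi> x \<bullet> \<pi> y" for x y
    using \<pi>b[of x] by (simp add: \<pi>_def[of y] inner_diff_right)
  \<comment> \<open>Rounding \<mu> leaves a vector whose component along b has at most half the length of b.\<close>
  have reduce: "(\<pi> x \<noteq> 0 \<longrightarrow> 3/4 * (b \<bullet> b) \<le> \<pi> x \<bullet> \<pi> x) \<and> (\<pi> x = 0 \<longrightarrow> \<mu> x \<in> \<int>)"
    if x: "x \<in> W" for x
  proof -
    define c where "c = round (\<mu> x)"
    define x' where "x' = x - of_int c *\<^sub>R b"
    have x'W: "x' \<in> W"
      unfolding x'_def using int_multiple_mem[OF W0 Wdiff b(1), of c] Wdiff x by blast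
    have "\<bar>\<mu> x - of_int c\<bar> \<le> 1/2"
      unfolding c_def using of_int_round_abs_le[of "\<mu> x"] by (simp add: abs_minus_commute)
    then have "(\<mu> x - of_int c)\<^sup>2 \<le> (1/2)\<^sup>2"
      by (metis abs_ge_zero power2_abs power_mono)
    then have small: "(\<mu> x - of_int c)\<^sup>2 * (b \<bullet> b) \<le> 1/4 * (b \<bullet> b)"
      using bb by (intro mult_right_mono) (auto simp: power2_eq_square)
    have dec: "x' = \<pi> x + (\<mu> x - of_int c) *\<^sub>R b"
      by (simp add: x'_def \<pi>_def algebra_simps)
    have norm: "x' \<bullet> x' = \<pi> x \<bullet> \<pi> x + (\<mu> x - of_int c)\<^sup>2 * (b \<bullet> b)"
      using \<pi>b[of x] unfolding dec
      by (simp add: inner_add_left inner_add_right power2_eq_square inner_commute)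
    show ?thesis
    proof (cases "x' = 0")
      case True
      then have "\<pi> x \<bullet> \<pi> x = 0 \<and> (\<mu> x - of_int c)\<^sup>2 * (b \<bullet> b) = 0"
        using norm bb by (smt (verit) inner_ge_zero inner_zero_left mult_nonneg_nonneg zero_le_power2)
      then show ?thesis using bb by simp
    next
      case False
      then have "b \<bullet> b \<le> x' \<bullet> x'" using bmin x'W by blast
      then have "3/4 * (b \<bullet> b) \<le> \<pi> x \<bullet> \<pi> x" using norm small by linarith
      moreover from this have "\<pi> x \<bullet> \<pi> x > 0" using bb by linarith
      ultimately show ?thesis by auto
    qed
  qed
  have span_\<pi>: "\<pi> x \<in> span W" if "x \<in> W" for x
    unfolding \<pi>_def using that b by (intro span_diff span_scale span_base)
  show ?case
  proof (cases "\<forall>x\<in>W. \<pi> x = 0")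
    case True
    have "1 / (b \<bullet> b) \<le> (4/3) ^ n / a"
      using a a_le bb by (intro frac_le one_le_power) auto
    moreover have "\<forall>x\<in>W. x \<bullet> (b /\<^sub>R (b \<bullet> b)) \<in> \<int>"
      using reduce True by (auto simp: \<mu>_def field_simps)
    moreover have "b /\<^sub>R (b \<bullet> b) \<in> span W" using b by (intro span_scale span_base)
    ultimately show ?thesis using b bb
      by (intro bexI[of _ "b /\<^sub>R (b \<bullet> b)"]) (auto simp: field_simps)
  next
    case False
    define W' where "W' = \<pi> ` W"
    have "dim ({b} \<union> W') = dim {b} + dim W'"
      by (rule dim_orthogonal_sum) (use \<pi>b in \<open>auto simp: W'_def inner_commute[of b]\<close>)
    moreover have "dim {b} = 1" using b by (simp add: dim_insert)
    moreover have "dim ({b} \<union> W') \<le> dim (span W)"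
      using b span_\<pi> by (intro dim_subset) (auto simp: W'_def span_base)
    ultimately have dimW': "Suc (dim W') \<le> dim W" by simp
    have "dim W' \<noteq> 0" using False by (auto simp: W'_def)
    then obtain m where n: "n = Suc m" using dimW dimW' by (cases n) (auto simp del: dim_eq_0)
    have bbM: "of_int M * (b \<bullet> b) \<in> \<int>" using disc b by blast
    then obtain N where N: "of_int M * (b \<bullet> b) = of_int N" by (auto simp: Ints_def)
    have Npos: "N > 0" using N M bb by (metis mult_pos_pos of_int_0_less_iff)
    have "\<exists>y\<in>span W'. y \<noteq> 0 \<and> (\<forall>x\<in>W'. x \<bullet> y \<in> \<int>) \<and> y \<bullet> y \<le> (4/3) ^ m / (3/4 * (b \<bullet> b))"
    proof (rule less.IH[of m W' "M * N"])
      show "m < n" using n by simp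
      show "0 \<in> W'" using W0 by (auto simp: W'_def \<pi>_def \<mu>_def intro!: image_eqI[of _ _ 0])
      show "x - y \<in> W'" if "x \<in> W'" "y \<in> W'" for x y
        using that Wdiff by (auto simp: W'_def \<pi>diff)
      show "0 < M * N" using M Npos by simp
      show "\<exists>x\<in>W'. x \<noteq> 0" using False by (auto simp: W'_def)
      show "dim W' \<le> Suc m" using dimW' dimW n by simp
      show "0 < 3/4 * (b \<bullet> b)" using bb by simp
      show "3/4 * (b \<bullet> b) \<le> x \<bullet> x" if "x \<in> W'" "x \<noteq> 0" for x
        using that reduce by (auto simp: W'_def)
      show "of_int (M * N) * (x \<bullet> y) \<in> \<int>" if xy: "x \<in> W'" "y \<in> W'" for x y
      proof -
        obtain u v where u: "u \<in> W" "x = \<pi> u" and v: "v \<in> W" "y = \<pi> v"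
          using xy unfolding W'_def by blast
        have "x \<bullet> y = u \<bullet> v - (u \<bullet> b) * (v \<bullet> b) / (b \<bullet> b)"
          unfolding u v using \<pi>inner[of u v] 
          by (simp add: \<pi>_def \<mu>_def inner_diff_left inner_diff_right inner_commute)
        moreover have "of_int (M * N) / (b \<bullet> b) = of_int M * (of_int M :: real)"
          using N bb by (simp add: field_simps)
        moreover have "of_int (M * N) * (u \<bullet> v - (u \<bullet> b) * (v \<bullet> b) / (b \<bullet> b)) =
            of_int (M * N) * (u \<bullet> v) - of_int (M * N) / (b \<bullet> b) * ((u \<bullet> b) * (v \<bullet> b))"
          by (simp add: algebra_simps)
        ultimately have "of_int (M * N) * (x \<bullet> y) =
            of_int (M * N) * (u \<bullet> v) - of_int M * of_int M * ((u \<bullet> b) * (v \<bullet> b))"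
          by (simp only:)
        also have "\<dots> =
            of_int N * (of_int M * (u \<bullet> v)) - (of_int M * (u \<bullet> b)) * (of_int M * (v \<bullet> b))"
          by (simp add: algebra_simps)
        finally show ?thesis using disc u v b by auto
      qed
    qed
    then obtain y where y: "y \<in> span W'" "y \<noteq> 0" "\<And>x. x \<in> W' \<Longrightarrow> x \<bullet> y \<in> \<int>"
      "y \<bullet> y \<le> (4/3) ^ m / (3/4 * (b \<bullet> b))" by blast
    have "orthogonal b y"
      by (rule orthogonal_to_span[OF y(1)]) (use \<pi>b in \<open>auto simp: W'_def orthogonal_def inner_commute[of b]\<close>)
    then have "\<pi> x \<bullet> y = x \<bullet> y" for x by (simp add: \<pi>_def inner_diff_left orthogonal_def)
    then have "\<forall>x\<in>W. x \<bullet> y \<in> \<int>" using y(3) by (metis W'_def imageI)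
    moreover have "y \<in> span W"
      using y(1) span_\<pi> span_mono[of W' "span W"] unfolding W'_def span_span by blast
    moreover have "(4/3) ^ m / (3/4 * (b \<bullet> b)) \<le> (4/3) ^ n / a"
    proof -
      have "(4/3) ^ m / (3/4 * (b \<bullet> b)) = (4/3) ^ n / (b \<bullet> b)" by (simp add: n)
      also have "\<dots> \<le> (4/3) ^ n / a" using a a_le by (intro frac_le) auto
      finally show ?thesis .
    qed
    ultimately show ?thesis using y by (intro bexI[of _ y]) auto
  qed
qed

section \<open>Self-dual lattices\<close>

text \<open>This single equation already makes \<open>U\<close> a group with integral inner products that is
  equal to its dual lattice.\<close>
definition self_dual :: "'a::real_inner set \<Rightarrow> bool" where
  "self_dual U \<longleftrightarrow> (\<forall>x. x \<in> U \<longleftrightarrow> (\<forall>u\<in>U. x \<bullet> u \<in> \<int>))"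

lemma self_dual_inner_Ints: "self_dual U \<Longrightarrow> x \<in> U \<Longrightarrow> y \<in> U \<Longrightarrow> x \<bullet> y \<in> \<int>"
  unfolding self_dual_def by blast

lemma self_dual_memI: "self_dual U \<Longrightarrow> (\<And>u. u \<in> U \<Longrightarrow> x \<bullet> u \<in> \<int>) \<Longrightarrow> x \<in> U"
  unfolding self_dual_def by blast

lemma self_dual_zero: "self_dual U \<Longrightarrow> 0 \<in> U"
  by (rule self_dual_memI) auto

lemma self_dual_diff: "self_dual U \<Longrightarrow> x \<in> U \<Longrightarrow> y \<in> U \<Longrightarrow> x - y \<in> U"
  by (rule self_dual_memI) (auto simp: inner_diff_left self_dual_inner_Ints)

lemma self_dual_int_multiple: "self_dual U \<Longrightarrow> x \<in> U \<Longrightarrow> of_int c *\<^sub>R x \<in> U"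
  by (rule self_dual_memI) (auto simp: self_dual_inner_Ints)

definition orthonormal :: "'a::real_inner set \<Rightarrow> bool" where
  "orthonormal E \<longleftrightarrow> (\<forall>e\<in>E. \<forall>f\<in>E. e \<bullet> f = (if e = f then 1 else 0))"

lemma orthonormal_independent:
  fixes E :: "'a::euclidean_space set"
  assumes "orthonormal E"
  shows "independent E" "finite E" "card E = dim E"
proof -
  have "0 \<notin> E" using assms unfolding orthonormal_def by (metis inner_zero_left zero_neq_one)
  moreover have "pairwise orthogonal E"
    using assms by (auto simp: orthonormal_def pairwise_def orthogonal_def)
  ultimately show ind: "independent E" by (intro pairwise_orthogonal_independent)
  then show "finite E" "card E = dim E"
    by (auto simp: independent_imp_finite dim_eq_card_independent)
qed

text \<open>The part \<open>W\<close> of \<open>U\<close> orthogonal to \<open>E\<close> is self-dual in the orthogonal complement of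
  \<open>E\<close>. So the short dual vector of \<open>W\<close> belongs to \<open>W\<close>, and if \<open>a\<close> is the squared minimum of
  \<open>W\<close>, then \<open>a \<le> (4/3)^4 / a\<close>, which forces \<open>a < 2\<close>. In dimension 6 the bound would be
  \<open>a^2 \<le> (4/3)^5\<close>, which is no longer below 4.\<close>
lemma self_dual_extend_orthonormal:
  fixes U :: "'a::euclidean_space set"
  assumes U: "self_dual U" and E: "E \<subseteq> U" "orthonormal E" and card: "card E < DIM('a)"
    and dim5: "DIM('a) \<le> 5"
  shows "\<exists>e\<in>U. e \<bullet> e = 1 \<and> (\<forall>f\<in>E. e \<bullet> f = 0)"
proof -
  note finE = orthonormal_independent(2)[OF E(2)]
  define p where "p x = x - (\<Sum>f\<in>E. (x \<bullet> f) *\<^sub>R f)" for x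
  have p_orth: "p x \<bullet> f = 0" if "f \<in> E" for x f
  proof -
    have "(\<Sum>g\<in>E. (x \<bullet> g) *\<^sub>R g) \<bullet> f = (\<Sum>g\<in>E. if g = f then x \<bullet> f else 0)"
      unfolding inner_sum_left using E(2) that
      by (intro sum.cong) (auto simp: orthonormal_def)
    then show ?thesis using that finE by (simp add: p_def inner_diff_left)
  qed
  have pU: "p x \<in> U" if "x \<in> U" for x
  proof (rule self_dual_memI[OF U])
    fix u assume u: "u \<in> U"
    have "(\<Sum>f\<in>E. (x \<bullet> f) *\<^sub>R f) \<bullet> u \<in> \<int>"
      unfolding inner_sum_left using E(1) U u that
      by (intro Ints_sum) (auto intro!: Ints_mult self_dual_inner_Ints[OF U])
    then show "p x \<bullet> u \<in> \<int>"
      unfolding p_def inner_diff_left using self_dual_inner_Ints[OF U that u] by auto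
  qed
  define W where "W = {x \<in> U. \<forall>f\<in>E. x \<bullet> f = 0}"
  have mem: "y \<in> W" if yE: "\<And>f. f \<in> E \<Longrightarrow> y \<bullet> f = 0" and yW: "\<And>x. x \<in> W \<Longrightarrow> x \<bullet> y \<in> \<int>" for y
  proof -
    have "y \<in> U"
    proof (rule self_dual_memI[OF U])
      fix u assume "u \<in> U"
      then have "p u \<bullet> y \<in> \<int>" using pU p_orth by (intro yW) (auto simp: W_def)
      moreover have "p u \<bullet> y = u \<bullet> y" 
        using yE by (simp add: p_def inner_diff_right inner_sum_right inner_commute[of _ y])
      ultimately show "y \<bullet> u \<in> \<int>" by (simp add: inner_commute)
    qed
    then show ?thesis using yE by (auto simp: W_def)
  qed
  have "\<not> (UNIV \<subseteq> span E)"
    using card orthonormal_independent(3)[OF E(2)] dim_subset[of UNIV "span E"] by auto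
  then have "span E \<noteq> UNIV" by auto
  then obtain z where z: "z \<noteq> 0" "\<And>x. x \<in> span E \<Longrightarrow> z \<bullet> x = 0"
    using span_not_UNIV_orthogonal[of E] by blast
  have "\<exists>x\<in>W. x \<noteq> 0"
  proof (rule ccontr)
    assume *: "\<not> (\<exists>x\<in>W. x \<noteq> 0)"
    then have "z \<in> W" using z by (intro mem) (auto simp: span_base)
    with * z show False by auto
  qed
  moreover have disc: "x \<bullet> y \<in> \<int>" if "x \<in> W" "y \<in> W" for x y
    using that U by (auto simp: W_def self_dual_inner_Ints)
  ultimately obtain e where e: "e \<in> W" "e \<noteq> 0" and emin: "\<And>x. x \<in> W \<Longrightarrow> x \<noteq> 0 \<Longrightarrow> e \<bullet> e \<le> x \<bullet> x"
    using exists_minimal_vector[of 1 W] by auto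
  have "dim W \<le> Suc 4" using dim_subset_UNIV[of W] dim5 by linarith
  then have "\<exists>y\<in>span W. y \<noteq> 0 \<and> (\<forall>x\<in>W. x \<bullet> y \<in> \<int>) \<and> y \<bullet> y \<le> (4/3) ^ 4 / (e \<bullet> e)"
    using e emin disc self_dual_zero[OF U] self_dual_diff[OF U]
    by (intro short_dual_vector[of W 1]) (auto simp: W_def inner_diff_left)
  then obtain y where y: "y \<in> span W" "y \<noteq> 0" "\<And>x. x \<in> W \<Longrightarrow> x \<bullet> y \<in> \<int>" "y \<bullet> y \<le> (4/3) ^ 4 / (e \<bullet> e)"
    by blast
  have "y \<bullet> f = 0" if "f \<in> E" for f
  proof -
    have "orthogonal f y" using that
      by (intro orthogonal_to_span[OF y(1)]) (auto simp: W_def orthogonal_def inner_commute)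
    then show ?thesis by (simp add: orthogonal_def inner_commute)
  qed
  then have "y \<in> W" using mem y(3) by blast
  then have "e \<bullet> e \<le> (4/3) ^ 4 / (e \<bullet> e)" using emin y by fastforce
  moreover have epos: "e \<bullet> e > 0" using e by simp
  ultimately have "(e \<bullet> e)\<^sup>2 \<le> 256 / 81" by (simp add: field_simps power2_eq_square)
  then have "(e \<bullet> e)\<^sup>2 < 2\<^sup>2" by simp
  then have "e \<bullet> e < 2" by (rule power2_less_imp_less) simp
  moreover obtain k where k: "e \<bullet> e = of_int k" using disc e(1) by (auto simp: Ints_def)
  ultimately have "k = 1" using epos by auto
  then show ?thesis using k e by (auto simp: W_def)
qed

lemma self_dual_orthonormal_basis:
  fixes U :: "'a::euclidean_space set"
  assumes U: "self_dual U" and dim5: "DIM('a) \<le> 5"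
  shows "\<exists>E\<subseteq>U. orthonormal E \<and> card E = DIM('a)"
proof -
  have "\<exists>E\<subseteq>U. orthonormal E \<and> card E = k" if "k \<le> DIM('a)" for k
    using that
  proof (induction k)
    case 0
    show ?case by (intro exI[of _ "{}"]) (auto simp: orthonormal_def)
  next
    case (Suc k)
    then obtain E where E: "E \<subseteq> U" "orthonormal E" "card E = k" by auto
    obtain e where e: "e \<in> U" "e \<bullet> e = 1" "\<forall>f\<in>E. e \<bullet> f = 0"
      using self_dual_extend_orthonormal[OF U E(1,2)] E(3) Suc.prems dim5 by auto
    have "orthonormal (insert e E)" using E e by (auto simp: orthonormal_def inner_commute)
    moreover have "e \<notin> E" using e by auto
    ultimately show ?case using E e orthonormal_independent(2)[OF E(2)]
      by (intro exI[of _ "insert e E"]) auto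
  qed
  then show ?thesis by blast
qed

lemma orthonormal_basis_inner:
  fixes E :: "'a::euclidean_space set"
  assumes "orthonormal E" "card E = DIM('a)"
  shows "x \<bullet> y = (\<Sum>e\<in>E. (x \<bullet> e) * (y \<bullet> e))"
proof -
  note E = orthonormal_independent[OF assms(1)]
  have "span E = UNIV" using E(3) assms(2) by (metis dim_eq_full)
  then have "orthogonal (x - (\<Sum>e\<in>E. (e \<bullet> x / (e \<bullet> e)) *\<^sub>R e)) y'" for y'
    using Gram_Schmidt_step[of E y' x] assms(1) 
    by (auto simp: orthonormal_def pairwise_def orthogonal_def inner_commute)
  then have "x = (\<Sum>e\<in>E. (e \<bullet> x / (e \<bullet> e)) *\<^sub>R e)"
    by (metis eq_iff_diff_eq_0 orthogonal_self)
  also have "\<dots> = (\<Sum>e\<in>E. (x \<bullet> e) *\<^sub>R e)"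
    using assms(1) by (intro sum.cong) (auto simp: orthonormal_def inner_commute)
  finally have "x \<bullet> y = (\<Sum>e\<in>E. (x \<bullet> e) *\<^sub>R e) \<bullet> y" by simp
  then show ?thesis by (simp add: inner_sum_left inner_commute[of y])
qed

section \<open>Neighbours of self-dual lattices\<close>

text \<open>Adjoin to \<open>U\<close> a vector \<open>v\<close> of integral squared length some multiple of which is in
  \<open>U\<close>, and keep only the vectors of \<open>U\<close> that are compatible with \<open>v\<close>. What is lost and what is
  gained have the same index \<open>n\<close>, the order of \<open>v\<close> modulo \<open>U\<close>: the inner products with \<open>v\<close>
  take all values in \<open>(1/n) \<int>\<close> modulo 1, since \<open>U\<close> is its own dual.\<close>
lemma self_dual_neighbour:
  fixes U :: "'a::real_inner set"
  assumes U: "self_dual U" and vv: "v \<bullet> v \<in> \<int>" and N: "N > 0" "of_nat N *\<^sub>R v \<in> U"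
  shows "self_dual {u + of_int k *\<^sub>R v | u k. u \<in> U \<and> u \<bullet> v \<in> \<int>}" (is "self_dual ?U'")
proof -
  define n where "n = (LEAST n. n > 0 \<and> of_nat n *\<^sub>R v \<in> U)"
  have n: "n > 0 \<and> of_nat n *\<^sub>R v \<in> U" unfolding n_def by (rule LeastI[of _ N]) (use N in auto)
  have nmin: "\<not> (m > 0 \<and> of_nat m *\<^sub>R v \<in> U)" if "m < n" for m
    using that not_less_Least unfolding n_def by blast
  have nuv: "of_nat n * (u \<bullet> v) \<in> \<int>" if "u \<in> U" for u
    using self_dual_inner_Ints[OF U that conjunct2[OF n]] by simp
  \<comment> \<open>The inner products with v generate 1/n modulo 1; otherwise a proper divisor m of n would
    give a vector m v in the dual of U, which is U.\<close>
  have "\<exists>t\<in>U. \<exists>k. of_nat n * (t \<bullet> v) = 1 + of_nat n * of_int k"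
  proof -
    define P where "P g \<longleftrightarrow> (\<exists>u\<in>U. \<exists>k. of_nat n * (u \<bullet> v) = of_int g + of_nat n * of_int k)" for g :: int
    have Pdiff: "P (g - q * h)" if gh: "P g" "P h" for g h q
    proof -
      obtain u k u' k' where *: "u \<in> U" "of_nat n * (u \<bullet> v) = of_int g + of_nat n * of_int k"
        "u' \<in> U" "of_nat n * (u' \<bullet> v) = of_int h + of_nat n * of_int k'" 
        using gh unfolding P_def by blast
      have "of_nat n * ((u - of_int q *\<^sub>R u') \<bullet> v) 
          = of_nat n * (u \<bullet> v) - of_int q * (of_nat n * (u' \<bullet> v))"
        by (simp add: inner_diff_left algebra_simps)
      also have "\<dots> = of_int (g - q * h) + of_nat n * of_int (k - q * k')"
        unfolding * by (simp add: algebra_simps)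
      finally show ?thesis
        unfolding P_def using self_dual_diff[OF U *(1) self_dual_int_multiple[OF U *(3)]] by blast
    qed
    have Pn: "P (int n)"
      unfolding P_def using self_dual_zero[OF U] by (intro bexI[of _ 0] exI[of _ "-1"]) auto
    define g where "g = int (LEAST g. g > 0 \<and> P (int g))"
    have "0 < (LEAST g. g > 0 \<and> P (int g)) \<and> P (int (LEAST g. g > 0 \<and> P (int g)))"
      by (rule LeastI[of _ n]) (use n Pn in auto)
    then have g: "g > 0" "P g" unfolding g_def by auto
    have gdvd: "g dvd h" if "P h" for h
    proof (rule ccontr)
      assume "\<not> g dvd h"
      then have "h mod g > 0" using g by (simp add: dvd_eq_mod_eq_0 order_less_le)
      moreover have "P (h mod g)" 
        using Pdiff[OF \<open>P h\<close> g(2), of "h div g"] by (simp add: minus_div_mult_eq_mod)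
      ultimately have "(LEAST g. g > 0 \<and> P (int g)) \<le> nat (h mod g)" by (intro Least_le) auto
      then have "g \<le> int (nat (h mod g))" unfolding g_def[symmetric] using g_def by linarith
      then have "g \<le> h mod g" using \<open>h mod g > 0\<close> by simp
      then show False using g pos_mod_bound[of g h] by linarith
    qed
    obtain m where m: "int n = g * m" using gdvd[OF Pn] by blast
    have mpos: "m > 0" using m n g by (metis of_nat_0_less_iff zero_less_mult_pos)
    have "of_nat (nat m) *\<^sub>R v \<in> U"
    proof (rule self_dual_memI[OF U])
      fix u assume u: "u \<in> U"
      obtain j where j: "of_nat n * (u \<bullet> v) = of_int j" using nuv[OF u] by (auto simp: Ints_def)
      then have "P j" unfolding P_def using u by (intro bexI[of _ u] exI[of _ 0]) auto
      then obtain i where "j = g * i" using gdvd by blast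
      then have "of_int g * (of_int m * (u \<bullet> v)) = of_int g * of_int i"
        using j m by (metis mult.assoc of_int_mult of_int_of_nat_eq)
      then show "of_nat (nat m) *\<^sub>R v \<bullet> u \<in> \<int>" using g mpos by (simp add: inner_commute)
    qed
    then have "\<not> nat m < n" using nmin[of "nat m"] mpos by auto
    then have "int n \<le> m" using mpos by (simp add: not_less le_nat_iff)
    then have "g * m \<le> 1 * m" using m by simp
    then have "g = 1" using mpos g by (simp add: mult_le_cancel_right)
    then show ?thesis using g(2) unfolding P_def by auto
  qed
  then obtain t k where t: "t \<in> U" "of_nat n * (t \<bullet> v) = 1 + of_nat n * of_int k" by blast
  show ?thesis
    unfolding self_dual_def
  proof (intro allI iffI ballI)
    fix x w assume "x \<in> ?U'" "w \<in> ?U'"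
    then obtain u1 k1 u2 k2 where "x = u1 + of_int k1 *\<^sub>R v" "u1 \<in> U" "u1 \<bullet> v \<in> \<int>" 
      "w = u2 + of_int k2 *\<^sub>R v" "u2 \<in> U" "u2 \<bullet> v \<in> \<int>" by blast
    then show "x \<bullet> w \<in> \<int>"
      using vv self_dual_inner_Ints[OF U] by (auto simp: inner_add_left inner_add_right inner_commute)
  next
    fix x assume x: "\<forall>w\<in>?U'. x \<bullet> w \<in> \<int>"
    have xu: "x \<bullet> u \<in> \<int>" if "u \<in> U" "u \<bullet> v \<in> \<int>" for u
    proof -
      have "u + of_int 0 *\<^sub>R v \<in> ?U'" using that by blast
      then show ?thesis using x by auto
    qed
    have "0 + of_int 1 *\<^sub>R v \<in> ?U'" using self_dual_zero[OF U] by fastforce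
    then have xv: "x \<bullet> v \<in> \<int>" using x by fastforce
    have "of_int (int n) *\<^sub>R t \<in> U" using self_dual_int_multiple[OF U t(1)] .
    then have "x \<bullet> (of_int (int n) *\<^sub>R t) \<in> \<int>" using nuv[OF t(1)] by (intro xu) auto
    then obtain c where c: "x \<bullet> (of_nat n *\<^sub>R t) = of_int c" by (auto simp: Ints_def)
    have "x - of_int c *\<^sub>R v \<in> U"
    proof (rule self_dual_memI[OF U])
      fix u assume u: "u \<in> U"
      obtain j where j: "of_nat n * (u \<bullet> v) = of_int j" using nuv[OF u] by (auto simp: Ints_def)
      have uv: "u \<bullet> v = of_int j / of_nat n" using j n by (simp add: field_simps)
      have xt: "x \<bullet> t = of_int c / of_nat n" using c n by (simp add: field_simps)
      have tv: "t \<bullet> v = 1 / of_nat n + of_int k" using t(2) n by (simp add: field_simps)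
      have "u - of_int j *\<^sub>R t \<in> U" 
        using self_dual_diff[OF U u self_dual_int_multiple[OF U t(1)]] .
      moreover have "(u - of_int j *\<^sub>R t) \<bullet> v = - of_int (j * k)"
        by (simp add: inner_diff_left uv tv algebra_simps)
      ultimately have "x \<bullet> (u - of_int j *\<^sub>R t) \<in> \<int>" by (intro xu) auto
      moreover have "(x - of_int c *\<^sub>R v) \<bullet> u = x \<bullet> (u - of_int j *\<^sub>R t)"
        using xt uv by (simp add: inner_diff_left inner_diff_right inner_commute[of v])
      ultimately show "(x - of_int c *\<^sub>R v) \<bullet> u \<in> \<int>" by simp
    qed
    moreover have "(x - of_int c *\<^sub>R v) \<bullet> v \<in> \<int>" using xv vv by (simp add: inner_diff_left)
    ultimately have "(x - of_int c *\<^sub>R v) + of_int c *\<^sub>R v \<in> ?U'" by blast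
    then show "x \<in> ?U'" by simp
  qed
qed

lemma common_denominator:
  assumes "finite I" "\<And>i. i \<in> I \<Longrightarrow> f i \<in> (\<rat> :: real set)"
  shows "\<exists>N>0. \<forall>i\<in>I. of_nat N * f i \<in> \<int>"
  using assms
proof (induction I)
  case empty
  show ?case by (intro exI[of _ 1]) auto
next
  case (insert i I)
  then obtain N where N: "N > 0" "\<And>i. i \<in> I \<Longrightarrow> of_nat N * f i \<in> \<int>" by auto
  obtain a b where ab: "b > 0" "f i = of_int a / of_int b"
    using insert.prems[of i] by (auto elim: Rats_cases')
  have "of_nat (N * nat b) * f j \<in> \<int>" if j: "j \<in> insert i I" for j
  proof (cases "j = i")
    case True
    then show ?thesis using ab by simp
  next
    case False
    then have "of_int b * (of_nat N * f j) \<in> \<int>" using j N by (intro Ints_mult N(2) Ints_of_int) auto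
    then show ?thesis using ab by (simp add: mult_ac)
  qed
  then show ?case using N(1) ab(1) by (intro exI[of _ "N * nat b"]) auto
qed

lemma self_dual_integer_lattice: "self_dual {x :: 'a::euclidean_space. \<forall>i\<in>Basis. x \<bullet> i \<in> \<int>}"
  unfolding self_dual_def
proof (intro allI iffI ballI)
  fix x u :: 'a
  assume "x \<in> {x. \<forall>i\<in>Basis. x \<bullet> i \<in> \<int>}" "u \<in> {x. \<forall>i\<in>Basis. x \<bullet> i \<in> \<int>}"
  then show "x \<bullet> u \<in> \<int>" unfolding euclidean_inner[of x u] by (intro Ints_sum) auto
next
  fix x :: 'a assume "\<forall>u\<in>{x. \<forall>i\<in>Basis. x \<bullet> i \<in> \<int>}. x \<bullet> u \<in> \<int>"
  then show "x \<in> {x. \<forall>i\<in>Basis. x \<bullet> i \<in> \<int>}" by (auto simp: inner_Basis)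
qed

text \<open>The hypothesis about \<open>N\<close> says that \<open>U\<close> is commensurable with the integer lattice, so
  that any rational vector has a multiple in \<open>U\<close>. It is restored in the conclusion in order
  that the step can be iterated.\<close>
lemma self_dual_adjoin:
  fixes U :: "'a::euclidean_space set"
  assumes U: "self_dual U" "N > 0" "\<And>x. (\<And>i. i \<in> Basis \<Longrightarrow> x \<bullet> i \<in> \<int>) \<Longrightarrow> of_nat N *\<^sub>R x \<in> U"
    and v: "\<And>i. i \<in> Basis \<Longrightarrow> v \<bullet> i \<in> \<rat>" "v \<bullet> v \<in> \<int>"
  shows "\<exists>U' N'. self_dual U' \<and> N' > 0 \<and> (\<forall>x. (\<forall>i\<in>Basis. x \<bullet> i \<in> \<int>) \<longrightarrow> of_nat N' *\<^sub>R x \<in> U')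
           \<and> v \<in> U' \<and> (\<forall>w\<in>U. w \<bullet> v \<in> \<int> \<longrightarrow> w \<in> U')"
proof -
  obtain L where L: "L > 0" "\<And>i. i \<in> Basis \<Longrightarrow> of_nat L * (v \<bullet> i) \<in> \<int>"
    using common_denominator[of Basis "\<lambda>i. v \<bullet> i"] v by auto
  define U' where "U' = {u + of_int k *\<^sub>R v | u k. u \<in> U \<and> u \<bullet> v \<in> \<int>}"
  have NLv: "of_nat (N * L) *\<^sub>R v \<in> U"
    using U(3)[of "of_nat L *\<^sub>R v"] L by simp
  have sd: "self_dual U'"
    unfolding U'_def by (rule self_dual_neighbour[OF U(1) v(2) _ NLv]) (use U(2) L(1) in auto)
  have keep: "w \<in> U'" if "w \<in> U" "w \<bullet> v \<in> \<int>" for w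
  proof -
    have "w + of_int 0 *\<^sub>R v \<in> U'" unfolding U'_def using that by blast
    then show ?thesis by simp
  qed
  have "of_nat (N * L) *\<^sub>R x \<in> U'" if x: "\<And>i. i \<in> Basis \<Longrightarrow> x \<bullet> i \<in> \<int>" for x
  proof (rule keep)
    have "of_int (int L) *\<^sub>R (of_nat N *\<^sub>R x) \<in> U"
      by (rule self_dual_int_multiple[OF U(1) U(3)[OF x]])
    then show "of_nat (N * L) *\<^sub>R x \<in> U" by (simp add: mult_ac)
    have "x \<bullet> (of_nat L *\<^sub>R v) \<in> \<int>"
      unfolding euclidean_inner[of x "of_nat L *\<^sub>R v"] using x L by (intro Ints_sum Ints_mult) auto
    then have "of_nat N * (x \<bullet> (of_nat L *\<^sub>R v)) \<in> \<int>" by (intro Ints_mult) auto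
    then show "of_nat (N * L) *\<^sub>R x \<bullet> v \<in> \<int>" by (simp add: mult_ac)
  qed
  moreover have "v \<in> U'"
  proof -
    have "0 + of_int 1 *\<^sub>R v \<in> U'" unfolding U'_def using self_dual_zero[OF U(1)] by fastforce
    then show ?thesis by simp
  qed
  moreover have "N * L > 0" using U(2) L(1) by simp
  ultimately show ?thesis using sd keep by blast
qed

text \<open>In dimension at most 5, a Gram matrix of integers that is realised by rational
  vectors is realised by integral ones: take the coordinates in an orthonormal basis of a
  self-dual lattice that contains both vectors.\<close>
lemma rational_vectors_integral_coordinates:
  fixes v w :: "'a::euclidean_space"
  assumes dim5: "DIM('a) \<le> 5"
    and "\<And>i. i \<in> Basis \<Longrightarrow> v \<bullet> i \<in> \<rat>" "\<And>i. i \<in> Basis \<Longrightarrow> w \<bullet> i \<in> \<rat>"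
    and "v \<bullet> v \<in> \<int>" "v \<bullet> w \<in> \<int>" "w \<bullet> w \<in> \<int>"
  shows "\<exists>(E::'a set) f g. finite E \<and> card E = DIM('a) \<and> v \<bullet> v = of_int (\<Sum>e\<in>E. (f e)\<^sup>2)
           \<and> v \<bullet> w = of_int (\<Sum>e\<in>E. f e * g e) \<and> w \<bullet> w = of_int (\<Sum>e\<in>E. (g e)\<^sup>2)"
proof -
  obtain U N where U: "self_dual U" "N > 0" "\<And>x. (\<And>i. i \<in> Basis \<Longrightarrow> x \<bullet> i \<in> \<int>) \<Longrightarrow> of_nat N *\<^sub>R x \<in> U"
    "v \<in> U"
    using self_dual_adjoin[OF self_dual_integer_lattice, of 1 v] assms by auto
  obtain U' where U': "self_dual U'" "v \<in> U'" "w \<in> U'"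
    using self_dual_adjoin[OF U(1-3), of w] assms U(4) by auto
  obtain E where E: "E \<subseteq> U'" "orthonormal E" "card E = DIM('a)"
    using self_dual_orthonormal_basis[OF U'(1) dim5] by blast
  have "\<exists>k::int. x \<bullet> e = of_int k" if "x \<in> U'" "e \<in> E" for x e
    using self_dual_inner_Ints[OF U'(1)] that E(1) by (meson Ints_cases subsetD)
  then obtain F where F: "\<And>x e. x \<in> U' \<Longrightarrow> e \<in> E \<Longrightarrow> x \<bullet> e = of_int (F x e)" by metis
  have "x \<bullet> y = of_int (\<Sum>e\<in>E. F x e * F y e)" if "x \<in> U'" "y \<in> U'" for x y
    using orthonormal_basis_inner[OF E(2,3), of x y] F that by simp
  then show ?thesis
    using U' E orthonormal_independent(2)[OF E(2)]
    by (intro exI[of _ E] exI[of _ "F v"] exI[of _ "F w"]) (auto simp: power2_eq_square)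
qed

section \<open>Divisor sums of a real character\<close>

definition sign_character :: "(nat \<Rightarrow> int) \<Rightarrow> bool" where
  "sign_character \<psi> \<longleftrightarrow> \<psi> 1 = 1 \<and> (\<forall>a b. \<psi> (a * b) = \<psi> a * \<psi> b) \<and> (\<forall>a. \<psi> a \<in> {-1, 0, 1})"

definition divisor_char_sum :: "(nat \<Rightarrow> int) \<Rightarrow> nat \<Rightarrow> int" where
  "divisor_char_sum \<psi> k = (\<Sum>d | d dvd k. \<psi> d)"

lemma sign_character_one: "sign_character \<psi> \<Longrightarrow> \<psi> (Suc 0) = 1"
  and sign_character_mult: "sign_character \<psi> \<Longrightarrow> \<psi> (a * b) = \<psi> a * \<psi> b"
  and sign_character_values: "sign_character \<psi> \<Longrightarrow> \<psi> a \<in> {-1, 0, 1}"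
  unfolding sign_character_def by (simp_all only: One_nat_def)

lemma sign_character_power: "sign_character \<psi> \<Longrightarrow> \<psi> (a ^ i) = \<psi> a ^ i"
  by (induction i) (simp_all add: sign_character_one sign_character_mult)

text \<open>The divisor sum of a multiplicative function is multiplicative; splitting off one
  prime at a time is enough for the sign information below.\<close>
lemma divisor_char_sum_prime_power:
  assumes \<psi>: "sign_character \<psi>" and p: "prime p" "\<not> p dvd k" and k: "k > 0"
  shows "divisor_char_sum \<psi> (p ^ e * k) = (\<Sum>i\<le>e. \<psi> p ^ i) * divisor_char_sum \<psi> k"
proof -
  let ?f = "\<lambda>(i, d). p ^ i * d"
  have inj: "inj_on ?f ({..e} \<times> {d. d dvd k})"
  proof (rule inj_onI, clarsimp)
    fix i d j d' assume *: "d dvd k" "d' dvd k" "p ^ i * d = p ^ j * d'"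
    have "\<not> p dvd d" "\<not> p dvd d'" "d > 0" "d' > 0" using * p k by (auto dest: dvd_trans intro: Nat.gr0I)
    then have "multiplicity p (p ^ i * d) = i" "multiplicity p (p ^ j * d') = j"
      using p by (auto intro!: multiplicity_eqI simp: prime_elem_multiplicity_mult_distrib 
          prime_elem_multiplicity_power_distrib not_dvd_imp_multiplicity_0)
    then have "i = j" using * by simp
    then show "i = j \<and> d = d'" using * p by (simp add: prime_gt_0_nat)
  qed
  have img: "{d. d dvd p ^ e * k} = ?f ` ({..e} \<times> {d. d dvd k})"
  proof (intro equalityI subsetI)
    fix x assume "x \<in> {d. d dvd p ^ e * k}"
    then obtain a b where ab: "x = a * b" "a dvd p ^ e" "b dvd k" by (auto elim: dvd_productE)
    then obtain i where "i \<le> e" "a = p ^ i" using p by (auto simp: divides_primepow_nat)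
    then show "x \<in> ?f ` ({..e} \<times> {d. d dvd k})" using ab by (intro image_eqI[of _ _ "(i, b)"]) auto
  qed (auto simp: le_imp_power_dvd mult_dvd_mono)
  have "divisor_char_sum \<psi> (p ^ e * k) = (\<Sum>(i, d)\<in>{..e} \<times> {d. d dvd k}. \<psi> p ^ i * \<psi> d)"
    unfolding divisor_char_sum_def img sum.reindex[OF inj]
    by (intro sum.cong) (auto simp: sign_character_mult[OF \<psi>] sign_character_power[OF \<psi>])
  also have "\<dots> = (\<Sum>i\<le>e. \<psi> p ^ i) * divisor_char_sum \<psi> k"
    by (simp add: divisor_char_sum_def sum_product sum.cartesian_product)
  finally show ?thesis .
qed

lemma sign_power_sum:
  assumes "x \<in> {-1, 0, 1 :: int}"
  shows "(\<Sum>i\<le>e. x ^ i) = (if x = 1 then int e + 1 else if x = 0 then 1 else if even e then 1 else 0)"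
  using assms by (induction e) auto

lemma prime_power_split_nat:
  fixes k :: nat
  assumes "k > 1"
  obtains p e k' where "prime p" "k = p ^ e * k'" "\<not> p dvd k'" "k' > 0" "k' < k"
proof -
  obtain p where p: "prime p" "p dvd k" using assms prime_factor_nat[of k] by auto
  define e where "e = multiplicity p k"
  have e0: "e > 0" using p assms by (auto simp: e_def prime_multiplicity_gt_zero_iff)
  obtain k' where k': "k = p ^ e * k'" "\<not> p dvd k'"
    using multiplicity_decompose'[of k p] assms p unfolding e_def
    by (metis not_prime_unit not_one_less_zero)
  have "k' > 0" using k' assms by (auto intro: Nat.gr0I)
  moreover have "p ^ e > 1" using p e0 by (metis one_less_power prime_gt_1_nat)
  moreover have "k' < k"
  proof -
    have "1 * k' < p ^ e * k'" using calculation by (intro mult_strict_right_mono) auto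
    then show ?thesis using k'(1) by simp
  qed
  ultimately show ?thesis using that[OF p(1) k'(1,2)] by blast
qed

lemma divisor_char_sum_one: "sign_character \<psi> \<Longrightarrow> divisor_char_sum \<psi> (Suc 0) = 1"
  by (simp add: divisor_char_sum_def sign_character_one)

lemma divisor_char_sum_nonneg:
  assumes \<psi>: "sign_character \<psi>" and "k > 0"
  shows "divisor_char_sum \<psi> k \<ge> 0"
  using assms(2)
proof (induction k rule: less_induct)
  case (less k)
  show ?case
  proof (cases "k = 1")
    case True
    then show ?thesis using divisor_char_sum_one[OF \<psi>] by simp
  next
    case False
    with less.prems have "k > 1" by simp
    then obtain p e k' where k: "prime p" "k = p ^ e * k'" "\<not> p dvd k'" "k' > 0" "k' < k"
      by (rule prime_power_split_nat)
    have "\<psi> p \<in> {-1, 0, 1}" by (rule sign_character_values[OF \<psi>])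
    then have "(\<Sum>i\<le>e. \<psi> p ^ i) \<ge> 0" by (subst sign_power_sum) auto
    then show ?thesis using divisor_char_sum_prime_power[OF \<psi> k(1,3,4)] less.IH[OF k(5,4)] k(2)
      by simp
  qed
qed

lemma divisor_char_sum_square:
  assumes \<psi>: "sign_character \<psi>" and "m > 0"
  shows "divisor_char_sum \<psi> (m\<^sup>2) \<ge> 1"
  using assms(2)
proof (induction m rule: less_induct)
  case (less m)
  show ?case
  proof (cases "m = 1")
    case True
    then show ?thesis using divisor_char_sum_one[OF \<psi>] by simp
  next
    case False
    with less.prems have "m > 1" by simp
    then obtain p e k where m: "prime p" "m = p ^ e * k" "\<not> p dvd k" "k > 0" "k < m"
      by (rule prime_power_split_nat)
    have "\<not> p dvd k\<^sup>2" using m by (auto simp: prime_dvd_power_iff)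
    have "\<psi> p \<in> {-1, 0, 1}" by (rule sign_character_values[OF \<psi>])
    then have s: "(\<Sum>i\<le>2 * e. \<psi> p ^ i) \<ge> 1" by (subst sign_power_sum) auto
    have "m\<^sup>2 = p ^ (2 * e) * k\<^sup>2" by (simp add: m(2) power_mult_distrib power_mult mult.commute)
    then have "divisor_char_sum \<psi> (m\<^sup>2) = (\<Sum>i\<le>2 * e. \<psi> p ^ i) * divisor_char_sum \<psi> (k\<^sup>2)"
      using divisor_char_sum_prime_power[OF \<psi> m(1) \<open>\<not> p dvd k\<^sup>2\<close>] m(4) by simp
    moreover have "divisor_char_sum \<psi> (k\<^sup>2) \<ge> 1" using less.IH m by blast
    ultimately show ?thesis using s by (metis mult_mono' mult_1 zero_le_one)
  qed
qed

text \<open>If \<open>\<psi>\<close> is a quadratic residue symbol, this says that the primes of odd multiplicity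
  in \<open>k\<close> are not inert.\<close>
lemma divisor_char_sum_pos_imp:
  assumes \<psi>: "sign_character \<psi>" and k: "k > 0" "divisor_char_sum \<psi> k > 0"
    and p: "prime p" "odd (multiplicity p k)"
  shows "\<psi> p \<noteq> -1"
proof
  assume *: "\<psi> p = -1"
  obtain k' where k': "k = p ^ multiplicity p k * k'" "\<not> p dvd k'"
    using multiplicity_decompose'[of k p] k p by (metis not_prime_unit not_gr0)
  have "k' > 0" using k' k by (auto intro: Nat.gr0I)
  have "(\<Sum>i\<le>multiplicity p k. \<psi> p ^ i) = 0" using p * by (subst sign_power_sum) auto
  then have "divisor_char_sum \<psi> k = 0"
    using divisor_char_sum_prime_power[OF \<psi> p(1) k'(2) \<open>k' > 0\<close>, of "multiplicity p k"]
    unfolding k'(1)[symmetric] by simp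
  with k show False by simp
qed

section \<open>A positive divisor sum in every residue class\<close>

lemma sum_residue_blocks:
  fixes f :: "nat \<Rightarrow> 'a::comm_monoid_add"
  shows "(\<Sum>a=1..n * J. f a) = (\<Sum>\<beta>=1..n. \<Sum>j<J. f (\<beta> + n * j))"
proof (induction J)
  case (Suc J)
  have "(\<Sum>a=1..n * Suc J. f a) = (\<Sum>a=1..n * J. f a) + (\<Sum>a=n * J + 1..n * J + n. f a)"
    using sum.ub_add_nat[of 1 "n * J" f n] by (simp add: add.commute)
  also have "(\<Sum>a=n * J + 1..n * J + n. f a) = (\<Sum>\<beta>=1..n. f (\<beta> + n * J))"
    using sum.shift_bounds_cl_nat_ivl[of f 1 "n * J" n] by (simp add: add.commute)
  finally show ?case using Suc by (simp add: sum.distrib)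
qed simp

text \<open>Summation by parts: the total variation of the weights, together with the last one,
  is the first one.\<close>
lemma abel_bounded_sum:
  fixes c :: "nat \<Rightarrow> int" and h :: "nat \<Rightarrow> real"
  assumes c: "\<And>J. \<bar>\<Sum>j<J. c j\<bar> \<le> 1" and h: "\<And>j. h (Suc j) \<le> h j" "\<And>j. 0 \<le> h j"
  shows "\<bar>\<Sum>j<J. of_int (c j) * h j\<bar> \<le> h 0"
proof -
  have "\<bar>(\<Sum>j<J. of_int (c j) * h j) - of_int (\<Sum>j<J. c j) * h J\<bar> \<le> h 0 - h J"
  proof (induction J)
    case (Suc J)
    let ?C = "of_int (\<Sum>j<Suc J. c j) :: real"
    have "\<bar>\<Sum>j<Suc J. c j\<bar> \<le> 1" by (rule c)
    then have "\<bar>?C\<bar> \<le> 1" by linarith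
    then have "\<bar>?C * (h J - h (Suc J))\<bar> \<le> h J - h (Suc J)"
      using h(1)[of J] by (simp add: abs_mult mult_left_le_one_le)
    moreover have "(\<Sum>j<Suc J. of_int (c j) * h j) - ?C * h (Suc J) =
        ((\<Sum>j<J. of_int (c j) * h j) - of_int (\<Sum>j<J. c j) * h J) + ?C * (h J - h (Suc J))"
      by (simp add: algebra_simps)
    ultimately show ?case using Suc by linarith
  qed simp
  moreover have "\<bar>\<Sum>j<J. c j\<bar> \<le> 1" by (rule c)
  then have "\<bar>of_int (\<Sum>j<J. c j) :: real\<bar> \<le> 1" by linarith
  then have "\<bar>of_int (\<Sum>j<J. c j) * h J\<bar> \<le> h J"
    using h(2)[of J] by (simp add: abs_mult mult_left_le_one_le)
  ultimately show ?thesis by linarith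
qed

lemma sum_over_products:
  fixes w :: "nat \<Rightarrow> real"
  assumes w: "\<And>k. k > K \<Longrightarrow> w k = 0" and "K \<le> A" "K \<le> B"
  shows "(\<Sum>b=1..B. \<Sum>a=1..A. of_int (\<psi> b) * w (a * b)) = (\<Sum>k=1..K. of_int (divisor_char_sum \<psi> k) * w k)"
proof -
  have "(\<Sum>b=1..B. \<Sum>a=1..A. of_int (\<psi> b) * w (a * b)) = 
        (\<Sum>(b, a)\<in>{1..B} \<times> {1..A}. of_int (\<psi> b) * w (a * b))"
    by (simp add: sum.cartesian_product)
  also have "\<dots> = (\<Sum>(b, a)\<in>{(b, a) \<in> {1..B} \<times> {1..A}. a * b \<le> K}. of_int (\<psi> b) * w (a * b))"
  proof (intro sum.mono_neutral_right)
    have "a * b \<le> K" if "w (a * b) \<noteq> 0" for a b using that w not_le by blast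
    then show "\<forall>x\<in>{1..B} \<times> {1..A} - {(b, a) \<in> {1..B} \<times> {1..A}. a * b \<le> K}.
        (case x of (b, a) \<Rightarrow> of_int (\<psi> b) * w (a * b)) = 0" by fastforce
  qed auto
  also have "\<dots> = (\<Sum>(k, d)\<in>(SIGMA k:{1..K}. {d. d dvd k}). of_int (\<psi> d) * w k)"
  proof (rule sum.reindex_bij_witness[of _ "\<lambda>(k, d). (d, k div d)" "\<lambda>(b, a). (a * b, b)"])
    fix x assume "x \<in> (SIGMA k:{1..K}. {d. d dvd k})"
    then obtain k d where x: "x = (k, d)" "1 \<le> k" "k \<le> K" "d dvd k" by auto
    then obtain a where "k = d * a" by (auto elim: dvdE)
    moreover from this have "d > 0" "a > 0" using x by (auto intro: Nat.gr0I)
    moreover from \<open>k = d * a\<close> have "d \<le> k" "a \<le> k"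
      using x by (auto intro!: dvd_imp_le)
    then have "d \<le> B" "a \<le> A" using x(3) assms(2,3) by linarith+
    ultimately show "(case x of (k, d) \<Rightarrow> (d, k div d)) \<in> {(b, a) \<in> {1..B} \<times> {1..A}. a * b \<le> K}"
      using x assms by (auto simp: mult.commute)
  qed (auto)
  also have "\<dots> = (\<Sum>k=1..K. of_int (divisor_char_sum \<psi> k) * w k)"
    by (subst sum.Sigma[symmetric]) (auto simp: divisor_char_sum_def sum_distrib_right)
  finally show ?thesis .
qed

text \<open>The truncated logarithm \<open>max 0 (L - ln k)\<close> is a convex function of \<open>ln k\<close>. Therefore
  the difference of its values at \<open>b p\<close> and \<open>b q\<close> decreases when \<open>b\<close> grows, which is what
  summation by parts asks of the weights. In the statement \<open>u\<close>, \<open>u'\<close>, \<open>p\<close>, \<open>q\<close> are the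
  logarithms.\<close>
lemma log_weight_mono:
  fixes L :: real
  assumes "u \<le> u'" "p \<le> q"
  shows "max 0 (L - (u' + p)) - max 0 (L - (u' + q)) \<le> max 0 (L - (u + p)) - max 0 (L - (u + q))"
  using assms by (auto simp: max_def)

text \<open>Write \<open>R\<close> for the divisor sums and \<open>W\<close> for the logarithmic weight of length \<open>K\<close>.
  Expanding \<open>R\<close>, the sum of \<open>R k W k\<close> over \<open>k = c\<close> modulo \<open>n\<close> is the sum over \<open>b\<close> of \<open>\<psi> b\<close>
  times the weights of the multiples \<open>a b = c\<close>, that is, of the \<open>a\<close> in one residue class \<open>\<alpha>\<close>
  modulo \<open>n\<close>, where \<open>\<alpha>\<close> depends on \<open>b\<close> modulo \<open>n\<close> only. The sum of \<open>R k W (n k)\<close> is the same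
  expression with the class of \<open>n\<close> in place of \<open>\<alpha>\<close>. For \<open>b\<close> in a fixed residue class \<open>\<beta>\<close>, the
  difference of the two weights is nonnegative, decreasing in \<open>b\<close> and at most \<open>ln K\<close>, while
  \<open>\<psi>\<close> has partial sums at most 1 in absolute value along \<open>\<beta>\<close>; so the two sums differ by at
  most \<open>n ln K\<close>. If \<open>R\<close> vanished on the residue class of \<open>c\<close>, then \<open>R k W (n k)\<close> would have a
  sum of at most \<open>n ln K\<close>, which contradicts the contribution of the squares \<open>k = m^2\<close>.\<close>
lemma exists_positive_divisor_sum:
  fixes \<psi> :: "nat \<Rightarrow> int" and n c :: nat
  assumes \<psi>: "sign_character \<psi>" and n: "n > 0"
    and coprime: "\<And>b. \<psi> b \<noteq> 0 \<Longrightarrow> coprime b n"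
    and block: "\<And>\<beta> J. \<bar>\<Sum>j<J. \<psi> (\<beta> + n * j)\<bar> \<le> 1"
  shows "\<exists>k>0. [k = c] (mod n) \<and> divisor_char_sum \<psi> k > 0"
proof (rule ccontr)
  assume "\<not> ?thesis"
  then have vanish: "divisor_char_sum \<psi> k = 0" if "k > 0" "[k = c] (mod n)" for k
    using that divisor_char_sum_nonneg[OF \<psi>, of k] by force
  have bound: "(\<Sum>m=1..M. ln (real K / (n * m\<^sup>2))) \<le> n * ln K" if KM: "K \<ge> n * M\<^sup>2" "M > 0" for K M :: nat
  proof -
    define W where "W k = (if k = 0 then 0 else max 0 (ln K - ln (real k)))" for k :: nat
    have K: "K > 0" using KM n by (metis gr0I le_zero_eq mult_is_0 not_gr0 zero_less_power)
    have W0: "W k = 0" if "k \<ge> K" for k using that K by (auto simp: W_def)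
    have Wnn: "W k \<ge> 0" for k by (auto simp: W_def)
    have Wanti: "W k' \<le> W k" if "0 < k" "k \<le> k'" for k k'
    proof -
      have "ln (real k) \<le> ln (real k')" using that by simp
      then have "ln (real K) - ln (real k') \<le> ln K - ln (real k)" by linarith
      then show ?thesis using that by (simp add: W_def max.coboundedI2)
    qed
    have Wlog: "W k \<le> ln K" if "k > 0" for k using that K by (auto simp: W_def)
    have Wmono: "W (b' * p) - W (b' * q) \<le> W (b * p) - W (b * q)" if "0 < b" "b \<le> b'" "0 < p" "p \<le> q" for b b' p q
      using that log_weight_mono[of "ln b" "ln b'" "ln p" "ln q" "ln K"]
      by (simp add: W_def ln_mult)
    have "\<exists>\<alpha>. \<alpha> \<in> {1..n} \<and> (\<forall>a. [a * \<beta> = c] (mod n) \<longleftrightarrow> [a = \<alpha>] (mod n))" if cop: "coprime \<beta> n" for \<beta> :: nat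
    proof -
      obtain x where x: "[\<beta> * x = 1] (mod n)" using cong_solve_coprime_nat[OF cop] by auto
      define \<alpha> where "\<alpha> = (if (c * x) mod n = 0 then n else (c * x) mod n)"
      have "\<alpha> \<in> {1..n}" using n by (auto simp: \<alpha>_def)
      moreover have \<alpha>: "[\<alpha> = c * x] (mod n)" by (auto simp: \<alpha>_def cong_def)
      moreover have "[a * \<beta> = c] (mod n) \<longleftrightarrow> [a = \<alpha>] (mod n)" for a
      proof -
        have "[a = \<alpha>] (mod n) \<longleftrightarrow> [a * \<beta> = \<alpha> * \<beta>] (mod n)" 
          using cong_mult_rcancel_nat[OF cop] by simp
        moreover have "[\<alpha> * \<beta> = c] (mod n)"
        proof -
          have "[\<alpha> * \<beta> = c * x * \<beta>] (mod n)" by (rule cong_scalar_right[OF \<alpha>])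
          also have "c * x * \<beta> = c * (\<beta> * x)" by simp
          also have "[\<dots> = c * 1] (mod n)" by (rule cong_scalar_left[OF x])
          finally show ?thesis by simp
        qed
        ultimately show ?thesis by (metis cong_sym cong_trans)
      qed
      ultimately show ?thesis by blast
    qed
    then obtain \<alpha> where \<alpha>: "\<And>\<beta>. coprime \<beta> n \<Longrightarrow> \<alpha> \<beta> \<in> {1..n}"
      "\<And>\<beta> a. coprime \<beta> n \<Longrightarrow> [a * \<beta> = c] (mod n) \<longleftrightarrow> [a = \<alpha> \<beta>] (mod n)" by metis
    have "n * K \<ge> K" using n by simp
    \<comment> \<open>Both double sums, collected by the product k = a b, are sums of divisor sums.\<close>
    have T1: "(\<Sum>b=1..n * K. \<Sum>a=1..n * K. of_int (\<psi> b) * (if [a * b = c] (mod n) then W (a * b) else 0)) = 0"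
    proof -
      have "(\<Sum>b=1..n * K. \<Sum>a=1..n * K. of_int (\<psi> b) * (if [a * b = c] (mod n) then W (a * b) else 0)) =
          (\<Sum>k=1..K. of_int (divisor_char_sum \<psi> k) * (if [k = c] (mod n) then W k else 0))"
        using W0 \<open>n * K \<ge> K\<close> by (intro sum_over_products[of K "\<lambda>k. if [k = c] (mod n) then W k else 0"]) auto
      also have "\<dots> = 0" using vanish by (intro sum.neutral) auto
      finally show ?thesis .
    qed
    have T2: "(\<Sum>b=1..n * K. \<Sum>a=1..K. of_int (\<psi> b) * W (n * (a * b))) \<ge> (\<Sum>m=1..M. ln (real K / (n * m\<^sup>2)))"
    proof -
      have *: "(\<Sum>b=1..n * K. \<Sum>a=1..K. of_int (\<psi> b) * W (n * (a * b))) =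
          (\<Sum>k=1..K. of_int (divisor_char_sum \<psi> k) * W (n * k))"
      proof (rule sum_over_products[of K "\<lambda>k. W (n * k)"])
        fix k assume "K < k"
        moreover have "1 * k \<le> n * k" using n by (intro mult_right_mono) auto
        ultimately have "K \<le> n * k" by linarith
        then show "W (n * k) = 0" by (rule W0)
      qed (use \<open>n * K \<ge> K\<close> in auto)
      have inj: "inj_on (\<lambda>m. m\<^sup>2) {1..M}" by (auto simp: inj_on_def)
      have le: "m\<^sup>2 \<le> K" if "m \<in> {1..M}" for m
      proof -
        have "1 * m\<^sup>2 \<le> n * M\<^sup>2" using that n by (intro mult_mono power_mono) auto
        then show ?thesis using KM by simp
      qed
      have "(\<Sum>m=1..M. ln (real K / (n * m\<^sup>2))) \<le> (\<Sum>m=1..M. of_int (divisor_char_sum \<psi> (m\<^sup>2)) * W (n * m\<^sup>2))"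
      proof (rule sum_mono)
        fix m assume m: "m \<in> {1..M}"
        have "ln (real K / (n * m\<^sup>2)) \<le> W (n * m\<^sup>2)"
          using m n K by (simp add: W_def ln_div)
        moreover have "1 \<le> real_of_int (divisor_char_sum \<psi> (m\<^sup>2))"
          using divisor_char_sum_square[OF \<psi>, of m] m by simp
        then have "1 * W (n * m\<^sup>2) \<le> of_int (divisor_char_sum \<psi> (m\<^sup>2)) * W (n * m\<^sup>2)"
          using Wnn by (intro mult_right_mono) auto
        ultimately show "ln (real K / (n * m\<^sup>2)) \<le> of_int (divisor_char_sum \<psi> (m\<^sup>2)) * W (n * m\<^sup>2)"
          by linarith
      qed
      also have "\<dots> = (\<Sum>k\<in>(\<lambda>m. m\<^sup>2) ` {1..M}. of_int (divisor_char_sum \<psi> k) * W (n * k))"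
        by (subst sum.reindex[OF inj]) (simp add: o_def)
      also have "\<dots> \<le> (\<Sum>k=1..K. of_int (divisor_char_sum \<psi> k) * W (n * k))"
        using le Wnn divisor_char_sum_nonneg[OF \<psi>] by (intro sum_mono2) auto
      finally show ?thesis unfolding * .
    qed
    \<comment> \<open>Collected by b instead, their difference consists of signed monotone weights h.\<close>
    have cop_shift: "coprime (\<beta> + n * j) n \<longleftrightarrow> coprime \<beta> n" for \<beta> j
      by (metis (no_types) add.commute coprime_iff_gcd_eq_1 gcd.commute gcd_add_mult mult.commute)
    define h where "h \<beta> j = (\<Sum>i<K. W ((\<beta> + n * j) * (\<alpha> \<beta> + n * i)) - W ((\<beta> + n * j) * (n + n * i)))" for \<beta> j
    have inner: "(\<Sum>a=1..n * K. of_int (\<psi> b) * (if [a * b = c] (mod n) then W (a * b) else 0)) 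
        - (\<Sum>a=1..K. of_int (\<psi> b) * W (n * (a * b))) = of_int (\<psi> b) * h \<beta> j"
      if b: "b = \<beta> + n * j" "\<beta> \<in> {1..n}" for b \<beta> j
    proof (cases "\<psi> b = 0")
      case False
      then have "coprime b n" by (rule coprime)
      then have cop: "coprime \<beta> n" using b cop_shift by simp
      have "[a * b = c] (mod n) \<longleftrightarrow> [a = \<alpha> \<beta>] (mod n)" for a
      proof -
        have "a * b = a * \<beta> + n * (a * j)" by (simp add: b(1) algebra_simps)
        then show ?thesis unfolding \<alpha>(2)[OF cop, symmetric] by (simp add: cong_def)
      qed
      then have "(\<Sum>a=1..n * K. (if [a * b = c] (mod n) then W (a * b) else 0)) =
          (\<Sum>\<gamma>=1..n. \<Sum>i<K. (if [\<gamma> + n * i = \<alpha> \<beta>] (mod n) then W ((\<gamma> + n * i) * b) else 0))"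
        by (simp only: sum_residue_blocks)
      also have "\<dots> = (\<Sum>\<gamma>=1..n. if \<gamma> = \<alpha> \<beta> then \<Sum>i<K. W ((\<alpha> \<beta> + n * i) * b) else 0)"
      proof (rule sum.cong[OF refl])
        fix \<gamma> assume \<gamma>: "\<gamma> \<in> {1..n}"
        have "[\<gamma> + n * i = \<alpha> \<beta>] (mod n) \<longleftrightarrow> \<gamma> = \<alpha> \<beta>" for i
        proof -
          have "[\<gamma> + n * i = \<alpha> \<beta>] (mod n) \<longleftrightarrow> \<gamma> mod n = \<alpha> \<beta> mod n" by (simp add: cong_def)
          also have "\<dots> \<longleftrightarrow> \<gamma> = \<alpha> \<beta>"
            using \<gamma> \<alpha>(1)[OF cop] by (cases "\<gamma> = n"; cases "\<alpha> \<beta> = n") auto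
          finally show ?thesis .
        qed
        then show "(\<Sum>i<K. (if [\<gamma> + n * i = \<alpha> \<beta>] (mod n) then W ((\<gamma> + n * i) * b) else 0)) =
            (if \<gamma> = \<alpha> \<beta> then \<Sum>i<K. W ((\<alpha> \<beta> + n * i) * b) else 0)" by auto
      qed
      also have "\<dots> = (\<Sum>i<K. W (b * (\<alpha> \<beta> + n * i)))"
        using \<alpha>(1)[OF cop] by (simp add: mult.commute)
      finally have 1: "(\<Sum>a=1..n * K. (if [a * b = c] (mod n) then W (a * b) else 0)) =
          (\<Sum>i<K. W (b * (\<alpha> \<beta> + n * i)))" .
      have 2: "(\<Sum>a=1..K. W (n * (a * b))) = (\<Sum>i<K. W (b * (n + n * i)))"
        by (rule sum.reindex_bij_witness[of _ Suc "\<lambda>a. a - 1"]) (auto simp: algebra_simps)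
      show ?thesis
        unfolding sum_distrib_left[symmetric] 1 2 h_def sum_subtractf b(1)[symmetric]
        by (simp add: algebra_simps)
    qed simp
    have hbound: "\<bar>\<Sum>j<K. of_int (\<psi> (\<beta> + n * j)) * h \<beta> j\<bar> \<le> ln K" if \<beta>: "\<beta> \<in> {1..n}" for \<beta>
    proof (cases "coprime \<beta> n")
      case False
      have "\<psi> (\<beta> + n * j) = 0" for j
        using coprime[of "\<beta> + n * j"] False cop_shift by auto
      then show ?thesis using K by simp
    next
      case True
      note \<alpha>n = \<alpha>(1)[OF True]
      have "\<bar>\<Sum>j<K. of_int (\<psi> (\<beta> + n * j)) * h \<beta> j\<bar> \<le> h \<beta> 0"
      proof (rule abel_bounded_sum[OF block])
        fix j
        show "h \<beta> (Suc j) \<le> h \<beta> j"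
          unfolding h_def using \<beta> \<alpha>n by (intro sum_mono Wmono) auto
        show "0 \<le> h \<beta> j"
          unfolding h_def using \<beta> \<alpha>n by (intro sum_nonneg) (auto intro!: Wanti)
      qed
      also have "h \<beta> 0 \<le> (\<Sum>i<K. W (\<beta> * (\<alpha> \<beta> + n * i)) - W (\<beta> * (\<alpha> \<beta> + n * Suc i)))"
        unfolding h_def using \<beta> \<alpha>n by (intro sum_mono) (auto intro!: Wanti mult_le_mono2)
      also have "\<dots> = W (\<beta> * \<alpha> \<beta>) - W (\<beta> * (\<alpha> \<beta> + n * K))"
        by (subst sum_lessThan_telescope') simp
      also have "\<dots> \<le> ln K" using Wlog[of "\<beta> * \<alpha> \<beta>"] Wnn[of "\<beta> * (\<alpha> \<beta> + n * K)"] \<beta> \<alpha>n by auto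
      finally show ?thesis .
    qed
    have "(\<Sum>b=1..n * K. \<Sum>a=1..K. of_int (\<psi> b) * W (n * (a * b))) =
        - (\<Sum>b=1..n * K. (\<Sum>a=1..n * K. of_int (\<psi> b) * (if [a * b = c] (mod n) then W (a * b) else 0)) 
        - (\<Sum>a=1..K. of_int (\<psi> b) * W (n * (a * b))))"
      unfolding sum_subtractf T1 by simp
    also have "\<dots> = - (\<Sum>\<beta>=1..n. \<Sum>j<K. of_int (\<psi> (\<beta> + n * j)) * h \<beta> j)"
      by (subst sum_residue_blocks) (intro arg_cong[of _ _ uminus] sum.cong refl inner)
    also have "\<dots> \<le> (\<Sum>\<beta>=1..n. \<bar>\<Sum>j<K. of_int (\<psi> (\<beta> + n * j)) * h \<beta> j\<bar>)"
      by (rule order_trans[OF abs_ge_minus_self sum_abs])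
    also have "\<dots> \<le> (\<Sum>\<beta>=1..n. ln K)" using hbound by (intro sum_mono) auto
    finally show ?thesis using T2 by simp
  qed
  \<comment> \<open>With this K every logarithm on the left of bound is at least ln 3 > 1, so that M \<le> n ln K;
    the constant 25 is large enough for the crude estimate ln x \<le> x to contradict this.\<close>
  define M where "M = 25 * n\<^sup>2"
  define K where "K = 3 * n * M\<^sup>2"
  have pos: "M > 0" "K > 0" using n by (auto simp: M_def K_def)
  have "real M = (\<Sum>m=1..M. 1)" by simp
  also have "\<dots> \<le> (\<Sum>m=1..M. ln (real K / (n * m\<^sup>2)))"
  proof (rule sum_mono)
    fix m assume m: "m \<in> {1..M}"
    have "real m ^ 2 \<le> real M ^ 2" using m by (intro power_mono) auto
    then have "(3::real) \<le> 3 * (real M ^ 2 / real m ^ 2)" using m by (simp add: field_simps)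
    also have "\<dots> = real K / (n * m\<^sup>2)" using n by (simp add: K_def)
    finally have "ln 3 \<le> ln (real K / (n * m\<^sup>2))" by simp
    moreover have "1 \<le> ln (3::real)" using exp_le by (simp add: ln_ge_iff)
    ultimately show "1 \<le> ln (real K / (n * m\<^sup>2))" by linarith
  qed
  also have "\<dots> \<le> n * ln K" using pos by (intro bound) (auto simp: K_def)
  also have "ln (real K) = ln (3 * n * (5 * n) ^ 4)" by (simp add: K_def M_def power_mult_distrib power_mult[symmetric])
  also have "\<dots> = ln (3 * n) + 4 * ln (5 * n)" 
  proof -
    have "ln (x * y ^ 4) = ln x + 4 * ln y" if "x > 0" "y > 0" for x y :: real
      using that by (simp add: ln_mult ln_realpow)
    from this[of "real (3 * n)" "real (5 * n)"] n show ?thesis by (simp only: of_nat_mult of_nat_power)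
  qed
  also have "real n * (ln (real (3 * n)) + 4 * ln (real (5 * n))) \<le> real n * (real (3 * n) + 4 * real (5 * n))"
    using ln_bound[of "real (3 * n)"] ln_bound[of "real (5 * n)"] n by (intro mult_left_mono) auto
  finally have "real M \<le> n * (3 * n + 4 * (5 * n))" by simp
  then show False using n by (simp add: M_def power2_eq_square)
qed

section \<open>Sums of three squares\<close>

lemma Legendre_values: "Legendre a p \<in> {-1, 0, 1}"
  by (simp add: Legendre_def)

lemma sign_eqI:
  fixes x y p :: int
  assumes "x \<in> {-1, 0, 1}" "y \<in> {-1, 0, 1}" "[x = y] (mod p)" "p > 2"
  shows "x = y"
proof -
  have "p dvd (x - y)" using assms(3) by (simp add: cong_iff_dvd_diff)
  moreover have "\<bar>x - y\<bar> < \<bar>p\<bar>" using assms(1,2,4) by auto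
  ultimately show ?thesis using dvd_imp_le_int[of "x - y" p] by linarith
qed

lemma Legendre_mult:
  assumes "prime p" "2 < p"
  shows "Legendre (a * b) (int p) = Legendre a p * Legendre b p"
proof (rule sign_eqI)
  let ?e = "(p - 1) div 2"
  have "[Legendre (a * b) p = (a * b) ^ ?e] (mod p)" by (rule euler_criterion[OF assms])
  also have "(a * b) ^ ?e = a ^ ?e * b ^ ?e" by (simp add: power_mult_distrib)
  also have "[\<dots> = Legendre a p * Legendre b p] (mod p)"
    by (intro cong_mult cong_sym[OF euler_criterion[OF assms]])
  finally show "[Legendre (a * b) p = Legendre a p * Legendre b p] (mod p)" .
qed (use assms Legendre_values[of a p] Legendre_values[of b p] Legendre_values[of "a * b" p] in auto)

lemma Legendre_cong: "[a = b] (mod p) \<Longrightarrow> Legendre a p = Legendre b p"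
proof -
  assume ab: "[a = b] (mod p)"
  have "[y = a] (mod p) \<longleftrightarrow> [y = b] (mod p)" "[a = y] (mod p) \<longleftrightarrow> [b = y] (mod p)" for y
    using ab by (meson cong_sym cong_trans)+
  then show ?thesis by (simp add: Legendre_def QuadRes_def)
qed

lemma Legendre_one: "prime p \<Longrightarrow> 2 < p \<Longrightarrow> Legendre 1 (int p) = 1"
proof -
  assume p: "prime p" "2 < p"
  have "\<not> [1 = 0] (mod int p)" using p by (simp add: cong_0_iff)
  moreover have "QuadRes (int p) 1" unfolding QuadRes_def by (intro exI[of _ 1]) simp
  ultimately show ?thesis by (simp add: Legendre_def)
qed

lemma Legendre_prod:
  assumes "prime p" "2 < p" "finite A"
  shows "Legendre (\<Prod>x\<in>A. f x) (int p) = (\<Prod>x\<in>A. Legendre (f x) p)"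
  using assms(3) by induction (auto simp: Legendre_mult[OF assms(1,2)] Legendre_one[OF assms(1,2)])

definition char4 :: "nat \<Rightarrow> int" where
  "char4 b = (if even b then 0 else if b mod 4 = 1 then 1 else -1)"

text \<open>For odd squarefree \<open>n = 1\<close> modulo 4 and odd \<open>b\<close> this is the Jacobi symbol
  \<open>(-n / b)\<close>, rewritten by quadratic reciprocity so that periodicity in \<open>b\<close> is visible.\<close>
definition jacobi_minus :: "nat \<Rightarrow> nat \<Rightarrow> int" where
  "jacobi_minus n b = char4 b * (\<Prod>p\<in>prime_factors n. Legendre (int b) (int p))"

lemma odd_mod_4: "odd (b::nat) \<Longrightarrow> b mod 4 = 1 \<or> b mod 4 = 3"
  by presburger

lemma char4_mult: "char4 (a * b) = char4 a * char4 b"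
proof (cases "odd a \<and> odd b")
  case True
  then have "a mod 4 = 1 \<or> a mod 4 = 3" "b mod 4 = 1 \<or> b mod 4 = 3" by (auto dest: odd_mod_4)
  moreover have "a * b mod 4 = ((a mod 4) * (b mod 4)) mod 4" by (simp add: mod_mult_eq)
  ultimately show ?thesis using True by (auto simp: char4_def)
qed (auto simp: char4_def)

lemma char4_prod: "finite A \<Longrightarrow> char4 (\<Prod>x\<in>A. f x) = (\<Prod>x\<in>A. char4 (f x))"
  by (induction rule: finite_induct) (auto simp: char4_mult, simp add: char4_def)

lemma char4_eq_power: "odd b \<Longrightarrow> char4 b = (-1) ^ ((b - 1) div 2)"
proof -
  assume "odd b"
  then obtain c where c: "b = 2 * c + 1" by (auto elim: oddE)
  have "char4 b = (if even c then 1 else -1)" unfolding char4_def c by presburger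
  then show ?thesis by (simp add: c)
qed

lemma odd_prime_factor: "odd n \<Longrightarrow> p \<in> prime_factors (n::nat) \<Longrightarrow> prime p \<and> 2 < p"
proof -
  assume n: "odd n" and "p \<in> prime_factors n"
  then have p: "prime p" "p dvd n" by (blast intro: prime_factors_dvd in_prime_factors_imp_prime in_prime_factors_imp_dvd)+
  then have "p \<noteq> 2" using n by auto
  then show ?thesis using p prime_ge_2_nat[OF p(1)] by simp
qed

lemma jacobi_minus_sign_character:
  assumes "odd n"
  shows "sign_character (jacobi_minus n)"
  unfolding sign_character_def
proof (intro conjI allI)
  note P = odd_prime_factor[OF assms]
  show "jacobi_minus n 1 = 1"
    using P by (simp add: jacobi_minus_def char4_def Legendre_one)
  show "jacobi_minus n (a * b) = jacobi_minus n a * jacobi_minus n b" for a b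
    using P by (simp add: jacobi_minus_def char4_mult Legendre_mult prod.distrib)
  have "(\<Prod>p\<in>A. Legendre (int a) (int p)) \<in> {-1, 0, 1}" if "finite A" for a and A :: "nat set"
    using that
  proof induction
    case (insert p A)
    then show ?case using Legendre_values[of "int a" "int p"] by auto
  qed auto
  then show "jacobi_minus n a \<in> {-1, 0, 1}" for a
    unfolding jacobi_minus_def char4_def using finite_set_mset by fastforce
qed

lemma jacobi_minus_coprime:
  assumes "n > 0" "jacobi_minus n b \<noteq> 0"
  shows "coprime b n"
proof (rule ccontr)
  assume "\<not> coprime b n"
  then have "gcd b n \<noteq> 1" using coprime_iff_gcd_eq_1 by blast
  then obtain p where p: "prime p" "p dvd b" "p dvd n" using prime_factor_nat[of "gcd b n"] by auto
  then have "p \<in> prime_factors n" using assms by (auto simp: prime_factors_dvd)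
  moreover have "Legendre (int b) (int p) = 0" using p by (simp add: Legendre_def cong_0_iff)
  ultimately have "(\<Prod>p\<in>prime_factors n. Legendre (int b) (int p)) = 0"
    by (intro prod_zero) auto
  then show False using assms by (simp add: jacobi_minus_def)
qed

text \<open>Along a residue class modulo \<open>n\<close> the product of Legendre symbols is constant, and
  since \<open>n = 1\<close> modulo 4 the other factor runs through the cycle \<open>0, 1, 0, -1\<close>.\<close>
lemma jacobi_minus_block:
  assumes n: "n mod 4 = 1"
  shows "\<bar>\<Sum>j<J. jacobi_minus n (\<beta> + n * j)\<bar> \<le> 1"
proof -
  let ?L = "\<lambda>b. \<Prod>p\<in>prime_factors n. Legendre (int b) (int p)"
  have "odd n" using n by presburger
  have "jacobi_minus n (\<beta> + n * j) = ?L \<beta> * char4 (\<beta> + j)" for j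
  proof -
    have "Legendre (int (\<beta> + n * j)) (int p) = Legendre (int \<beta>) (int p)" if "p \<in> prime_factors n" for p
    proof (rule Legendre_cong)
      have "p dvd n" using that by (auto simp: prime_factors_dvd)
      then have "[\<beta> + n * j = \<beta>] (mod p)" by (simp add: cong_add_lcancel_0_nat cong_0_iff)
      then show "[int (\<beta> + n * j) = int \<beta>] (mod int p)" by (simp only: cong_int_iff)
    qed
    then have "?L (\<beta> + n * j) = ?L \<beta>" by (intro prod.cong) auto
    moreover have "[\<beta> + n * j = \<beta> + 1 * j] (mod 4)"
      using n by (intro cong_add cong_mult cong_refl) (simp add: cong_def)
    then have "(\<beta> + n * j) mod 4 = (\<beta> + j) mod 4" "even (\<beta> + n * j) = even (\<beta> + j)"
      using \<open>odd n\<close> by (auto simp: cong_def)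
    then have "char4 (\<beta> + n * j) = char4 (\<beta> + j)" 
      unfolding char4_def by simp
    ultimately show ?thesis by (simp add: jacobi_minus_def)
  qed
  then have "(\<Sum>j<J. jacobi_minus n (\<beta> + n * j)) = ?L \<beta> * (\<Sum>j<J. char4 (\<beta> + j))"
    by (simp add: sum_distrib_left)
  moreover have "\<bar>?L \<beta>\<bar> \<le> 1"
    unfolding abs_prod by (intro prod_le_1) (auto simp: Legendre_def)
  moreover have "\<bar>\<Sum>j<J. char4 (\<beta> + j)\<bar> \<le> 1"
  proof -
    have P: "(\<Sum>i<x. char4 i) = (if x mod 4 = 2 \<or> x mod 4 = 3 then 1 else 0)" for x
    proof (induction x)
      case (Suc x)
      then show ?case unfolding sum.lessThan_Suc Suc char4_def by (auto; presburger)
    qed simp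
    have "(\<Sum>i<\<beta> + J. char4 i) = (\<Sum>i<\<beta>. char4 i) + (\<Sum>j<J. char4 (\<beta> + j))"
      by (induction J) auto
    then show ?thesis unfolding P by (auto split: if_splits)
  qed
  ultimately show ?thesis by (simp add: abs_mult mult_le_one)
qed

text \<open>Quadratic reciprocity. The signs it produces multiply to a power of the character
  modulo 4 at \<open>n\<close>, which is 1.\<close>
lemma jacobi_minus_prime:
  assumes n: "n mod 4 = 1" "squarefree n" and l: "prime l" "2 < l" "\<not> l dvd n"
  shows "jacobi_minus n l = Legendre (- int n) (int l)"
proof -
  have "odd n" using n by presburger
  note P = odd_prime_factor[OF this]
  have oddl: "odd l" using l prime_odd_nat by blast
  have nprod: "n = (\<Prod>p\<in>prime_factors n. p)"
  proof -
    have "n > 0" using \<open>odd n\<close> by (auto intro: Nat.gr0I)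
    then have "n = (\<Prod>p\<in>prime_factors n. p ^ multiplicity p n)" by (rule prime_factorization_nat)
    also have "\<dots> = (\<Prod>p\<in>prime_factors n. p)"
      using n(2) \<open>n > 0\<close> by (intro prod.cong) (simp_all add: squarefree_factorial_semiring')
    finally show ?thesis .
  qed
  have recip: "Legendre (int p) (int l) = Legendre (int l) (int p) * char4 p ^ ((l - 1) div 2)"
    if p: "p \<in> prime_factors n" for p
  proof -
    have pl: "p \<noteq> l" using p l by (auto simp: prime_factors_dvd)
    have "odd p" using P[OF p] prime_odd_nat by blast
    have "\<not> p dvd l" using P[OF p] l pl by (metis primes_dvd_imp_eq)
    then have "Legendre (int l) (int p) \<noteq> 0"
      by (auto simp: Legendre_def cong_0_iff)
    then have sq: "Legendre (int l) (int p) * Legendre (int l) (int p) = 1"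
      using Legendre_values[of "int l" "int p"] by auto
    have "Legendre (int p) (int l) * Legendre (int l) (int p) = (-1) ^ ((p - 1) div 2 * ((l - 1) div 2))"
      using Quadratic_Reciprocity P[OF p] l pl by blast
    also have "\<dots> = char4 p ^ ((l - 1) div 2)"
      unfolding char4_eq_power[OF \<open>odd p\<close>] by (simp add: power_mult)
    finally have LM: "Legendre (int p) (int l) * Legendre (int l) (int p) = char4 p ^ ((l - 1) div 2)" .
    have "Legendre (int p) (int l) = Legendre (int p) (int l) * (Legendre (int l) (int p) * Legendre (int l) (int p))"
      unfolding sq by simp
    also have "\<dots> = Legendre (int l) (int p) * char4 p ^ ((l - 1) div 2)"
      unfolding LM[symmetric] by (simp only: mult_ac)
    finally show ?thesis .
  qed
  have "Legendre (-1) (int l) = char4 l"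
  proof (rule sign_eqI)
    show "[Legendre (-1) (int l) = char4 l] (mod int l)"
      unfolding char4_eq_power[OF oddl] by (rule euler_criterion[OF l(1,2)])
    show "char4 l \<in> {-1, 0, 1}" by (auto simp: char4_def)
  qed (use Legendre_values l in auto)
  moreover have "Legendre (int n) (int l) = (\<Prod>p\<in>prime_factors n. Legendre (int l) (int p))"
  proof -
    have "int n = (\<Prod>p\<in>prime_factors n. int p)"
      using arg_cong[OF nprod, of int] by (simp only: of_nat_prod)
    then have "Legendre (int n) (int l) = Legendre (\<Prod>p\<in>prime_factors n. int p) (int l)"
      by (rule arg_cong)
    also have "\<dots> = (\<Prod>p\<in>prime_factors n. Legendre (int p) (int l))"
      by (rule Legendre_prod[OF l(1,2)]) simp
    also have "\<dots> = (\<Prod>p\<in>prime_factors n. Legendre (int l) (int p)) * (\<Prod>p\<in>prime_factors n. char4 p) ^ ((l - 1) div 2)"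
      using recip by (simp add: prod.distrib prod_power_distrib)
    also have "(\<Prod>p\<in>prime_factors n. char4 p) = char4 n"
      using char4_prod[of "prime_factors n" "\<lambda>p. p"] unfolding nprod[symmetric] by simp
    also have "char4 n = 1" using n \<open>odd n\<close> by (simp add: char4_def)
    finally show ?thesis by simp
  qed
  moreover have "Legendre (- int n) (int l) = Legendre (-1) l * Legendre n l"
    using Legendre_mult[OF l(1,2), of "-1" "int n"] by simp
  ultimately show ?thesis by (simp add: jacobi_minus_def)
qed

lemma square_root_mod_squarefree:
  fixes q :: nat and n :: int
  assumes "squarefree q" "\<And>l. prime l \<Longrightarrow> l dvd q \<Longrightarrow> \<exists>x. int l dvd x\<^sup>2 + n"
  shows "\<exists>x. int q dvd x\<^sup>2 + n"
  using assms
proof (induction q rule: less_induct)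
  case (less q)
  show ?case
  proof (cases "q = 1")
    case False
    then obtain l where l: "prime l" "l dvd q" using prime_factor_nat by blast
    then obtain q' where q: "q = l * q'" by (auto elim: dvdE)
    have "q \<noteq> 0" using less.prems(1) by (metis not_squarefree_0)
    then have "q' < q" using q prime_gt_1_nat[OF l(1)] by simp
    have "\<not> l dvd q'"
    proof
      assume "l dvd q'"
      then have "l\<^sup>2 dvd q" unfolding q power2_eq_square by (rule mult_dvd_mono[OF dvd_refl])
      then have "l dvd 1" by (rule squarefreeD[OF less.prems(1)])
      then show False using l(1) not_prime_unit by blast
    qed
    then have sf: "squarefree q'" "coprime l q'"
      using less.prems(1) l(1) unfolding q by (auto dest: squarefree_multD intro: prime_imp_coprime)
    obtain x where x: "int q' dvd x\<^sup>2 + n"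
      using less.IH[OF \<open>q' < q\<close> sf(1)] less.prems(2) q by (meson dvd_mult)
    obtain y where y: "int l dvd y\<^sup>2 + n" using less.prems(2) l by blast
    have "coprime (int l) (int q')" using sf by simp
    then obtain z where z: "[z = y] (mod int l)" "[z = x] (mod int q')"
      using binary_chinese_remainder_int by blast
    have "[z\<^sup>2 + n = y\<^sup>2 + n] (mod int l)" "[z\<^sup>2 + n = x\<^sup>2 + n] (mod int q')"
      using z by (auto intro: cong_add cong_pow)
    then have "int l dvd z\<^sup>2 + n" "int q' dvd z\<^sup>2 + n"
      using x y cong_dvd_iff by blast+
    then have "int q dvd z\<^sup>2 + n"
      unfolding q of_nat_mult by (intro divides_mult) (use sf in auto)
    then show ?thesis by blast
  qed auto
qed

text \<open>Here \<open>q\<close> is the squarefree part of \<open>k = q m^2\<close>, with \<open>k = -1\<close> modulo \<open>n\<close> and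
  positive divisor sum. Modulo \<open>n\<close>, \<open>-q\<close> is the square of an inverse of \<open>m\<close>. Every odd prime
  factor of \<open>q\<close> has odd multiplicity in \<open>k\<close>, so \<open>-n\<close> is a square modulo it, and then modulo
  \<open>q\<close> by the Chinese remainder theorem; \<open>h\<close> is an inverse of a root.\<close>
lemma exists_auxiliary_determinant:
  fixes n :: nat
  assumes n: "n mod 4 = 1" "squarefree n"
  shows "\<exists>q r h :: int. q > 0 \<and> int n dvd r\<^sup>2 + q \<and> q dvd int n * h\<^sup>2 + 1"
proof -
  have "odd n" using n by presburger
  then have "n > 0" by (auto intro: Nat.gr0I)
  obtain k where k: "k > 0" "[k = n - 1] (mod n)" "divisor_char_sum (jacobi_minus n) k > 0"
    using exists_positive_divisor_sum[OF jacobi_minus_sign_character[OF \<open>odd n\<close>] \<open>n > 0\<close>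
        jacobi_minus_coprime[OF \<open>n > 0\<close>] jacobi_minus_block[OF n(1)]] by blast
  have k1: "n dvd k + 1"
  proof -
    have "[k + 1 = (n - 1) + 1] (mod n)" using k(2) by (intro cong_add) auto
    then show ?thesis using \<open>n > 0\<close> by (simp add: cong_dvd_iff)
  qed
  then have "coprime k n" 
    by (metis coprime_Suc_right_nat coprime_commute coprime_divisors dvd_refl Suc_eq_plus1)
  define q where "q = squarefree_part k"
  define m where "m = square_part k"
  have km: "k = q * m\<^sup>2" unfolding q_def m_def by (rule squarefree_decompose)
  have q: "q > 0" "squarefree q" unfolding q_def by (auto intro: Nat.gr0I)
  have cop: "coprime q n" "coprime m n" using \<open>coprime k n\<close> unfolding km by auto
  obtain r where r: "[int m * r = 1] (mod int n)"
    using cong_solve_coprime_int[of "int m" "int n"] cop by auto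
  have "int n dvd r\<^sup>2 + int q"
  proof -
    have "[r\<^sup>2 + int q * 1\<^sup>2 = r\<^sup>2 + int q * (int m * r)\<^sup>2] (mod int n)"
      by (intro cong_add cong_mult cong_pow cong_sym[OF r]) auto
    also have "r\<^sup>2 + int q * (int m * r)\<^sup>2 = r\<^sup>2 * int (k + 1)"
      by (simp add: km power_mult_distrib algebra_simps)
    finally have "[r\<^sup>2 + int q = r\<^sup>2 * int (k + 1)] (mod int n)" by simp
    moreover have "int n dvd r\<^sup>2 * int (k + 1)" using k1 by (metis dvd_mult of_nat_dvd_iff)
    ultimately show ?thesis using cong_dvd_iff by blast
  qed
  moreover have "\<exists>x. int q dvd x\<^sup>2 + int n"
  proof (rule square_root_mod_squarefree[OF q(2)])
    fix l assume l: "prime l" "l dvd q"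
    show "\<exists>x. int l dvd x\<^sup>2 + int n"
    proof (cases "l = 2")
      case True
      then show ?thesis using \<open>odd n\<close> by (intro exI[of _ 1]) auto
    next
      case False
      then have l2: "2 < l" using prime_gt_1_nat[OF l(1)] by simp
      have "\<not> l dvd n" using cop(1) l by (metis coprime_common_divisor_nat dvd_refl not_prime_1)
      have "multiplicity l q > 0" using l q(1) by (simp add: prime_multiplicity_gt_zero_iff)
      then have "multiplicity l k mod 2 > 0"
        unfolding q_def prime_multiplicity_squarefree_part[OF l(1)] .
      then have "odd (multiplicity l k)" by presburger
      then have "jacobi_minus n l \<noteq> -1"
        using divisor_char_sum_pos_imp[OF jacobi_minus_sign_character[OF \<open>odd n\<close>] k(1,3) l(1)] by blast
      then have "Legendre (- int n) (int l) \<noteq> -1"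
        using jacobi_minus_prime[OF n l(1) l2 \<open>\<not> l dvd n\<close>] by simp
      then have "[- int n = 0] (mod int l) \<or> QuadRes (int l) (- int n)"
        by (auto simp: Legendre_def split: if_splits)
      moreover have "\<not> [- int n = 0] (mod int l)" using \<open>\<not> l dvd n\<close> by (simp add: cong_0_iff)
      ultimately obtain y where "[y\<^sup>2 = - int n] (mod int l)" by (auto simp: QuadRes_def)
      then have "int l dvd y\<^sup>2 - (- int n)" by (simp only: cong_iff_dvd_diff)
      then show ?thesis by auto
    qed
  qed
  then obtain x where x: "int q dvd x\<^sup>2 + int n" by blast
  have "coprime x (int q)"
  proof (rule coprimeI)
    fix d assume d: "d dvd x" "d dvd int q"
    then have "d dvd (x\<^sup>2 + int n) - x\<^sup>2" using x by (intro dvd_diff) (auto intro: dvd_trans)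
    then have "d dvd int n" by simp
    then show "is_unit d" using d(2) cop(1) by (metis coprime_common_divisor coprime_int_iff)
  qed
  then obtain h where h: "[x * h = 1] (mod int q)" using cong_solve_coprime_int by blast
  have "int q dvd int n * h\<^sup>2 + 1"
  proof -
    have "[int n * h\<^sup>2 + 1\<^sup>2 = int n * h\<^sup>2 + (x * h)\<^sup>2] (mod int q)"
      by (intro cong_add cong_pow cong_sym[OF h]) auto
    also have "int n * h\<^sup>2 + (x * h)\<^sup>2 = h\<^sup>2 * (x\<^sup>2 + int n)" by (simp add: algebra_simps)
    finally show ?thesis using x by (metis cong_dvd_iff dvd_mult one_power2)
  qed
  ultimately show ?thesis using q(1) by (intro exI[of _ "int q"] exI[of _ r] exI[of _ h]) auto
qed

text \<open>With \<open>b = (r^2 + q) / n\<close> and \<open>s = (n h^2 + 1) / q\<close>, the matrix with rows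
  \<open>(n, r, 0)\<close>, \<open>(r, b, h)\<close>, \<open>(0, h, s)\<close> is positive definite of determinant
  \<open>(n b - r^2) s - n h^2 = q s - n h^2 = 1\<close>. The vectors \<open>v1\<close>, \<open>v2\<close>, \<open>v3\<close> are its Cholesky
  factor; they span a self-dual lattice, and \<open>v1\<close> has squared length \<open>n\<close>.\<close>
lemma three_squares_of_auxiliary:
  fixes n q r h :: int
  assumes n: "n > 0" and q: "q > 0" and "n dvd r\<^sup>2 + q" "q dvd n * h\<^sup>2 + 1"
  shows "\<exists>x y z :: int. n = x\<^sup>2 + y\<^sup>2 + z\<^sup>2"
proof -
  obtain b s where b: "r\<^sup>2 + q = n * b" and s: "n * h\<^sup>2 + 1 = q * s" using assms by (auto elim!: dvdE)
  define v1 v2 v3 :: "real \<times> real \<times> real" where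
    "v1 = (sqrt n, 0, 0)" and "v2 = (r / sqrt n, sqrt (q / n), 0)" and "v3 = (0, h * sqrt (n / q), 1 / sqrt q)"
  have nb: "of_int n * of_int b = (of_int r)\<^sup>2 + (of_int q :: real)"
    and qs: "of_int q * of_int s = of_int n * (of_int h)\<^sup>2 + (1::real)"
    using b s by (metis of_int_add of_int_mult of_int_power of_int_1)+
  have inn: "v1 \<bullet> v1 = n" "v1 \<bullet> v2 = r" "v1 \<bullet> v3 = 0" "v2 \<bullet> v2 = b" "v2 \<bullet> v3 = h" "v3 \<bullet> v3 = s"
    using n q nb qs
    by (simp_all add: v1_def v2_def v3_def real_sqrt_divide field_simps power2_eq_square)
  have inn': "v2 \<bullet> v1 = r" "v3 \<bullet> v1 = 0" "v3 \<bullet> v2 = h"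
    using inn by (simp_all add: inner_commute)
  define U where "U = {of_int i *\<^sub>R v1 + of_int j *\<^sub>R v2 + of_int k *\<^sub>R v3 | i j k :: int. True}"
  have "of_int 1 *\<^sub>R v1 + of_int 0 *\<^sub>R v2 + of_int 0 *\<^sub>R v3 \<in> U"
    "of_int 0 *\<^sub>R v1 + of_int 1 *\<^sub>R v2 + of_int 0 *\<^sub>R v3 \<in> U"
    "of_int 0 *\<^sub>R v1 + of_int 0 *\<^sub>R v2 + of_int 1 *\<^sub>R v3 \<in> U"
    unfolding U_def by blast+
  then have vU: "v1 \<in> U" "v2 \<in> U" "v3 \<in> U" by simp_all
  have "self_dual U"
    unfolding self_dual_def
  proof (intro allI iffI ballI)
    fix x u assume "x \<in> U" "u \<in> U"
    then obtain i j k i' j' k' :: int where xu: "x = of_int i *\<^sub>R v1 + of_int j *\<^sub>R v2 + of_int k *\<^sub>R v3"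
      "u = of_int i' *\<^sub>R v1 + of_int j' *\<^sub>R v2 + of_int k' *\<^sub>R v3" 
      unfolding U_def by blast
    have "x \<bullet> u = of_int (i * i' * n + (i * j' + j * i') * r + j * j' * b + (j * k' + k * j') * h + k * k' * s)"
      by (simp add: xu inner_add_left inner_add_right inn inn' algebra_simps)
    then show "x \<bullet> u \<in> \<int>" by (metis Ints_of_int)
  next
    fix x assume x: "\<forall>u\<in>U. x \<bullet> u \<in> \<int>"
    from vU obtain c1 c2 c3 where c: "x \<bullet> v1 = of_int c1" "x \<bullet> v2 = of_int c2" "x \<bullet> v3 = of_int c3"
      using x by (meson Ints_cases)
    \<comment> \<open>The rows of the inverse of the Gram matrix, which is integral because the determinant is 1.\<close>
    define i where "i = (b * s - h\<^sup>2) * c1 - r * s * c2 + r * h * c3"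
    define j where "j = - r * s * c1 + n * s * c2 - n * h * c3"
    define k where "k = r * h * c1 - n * h * c2 + q * c3"
    define y where "y = of_int i *\<^sub>R v1 + of_int j *\<^sub>R v2 + of_int k *\<^sub>R v3"
    \<comment> \<open>The residuals of the system are combinations of the two relations for b and s.\<close>
    have z: "n * b - r\<^sup>2 - q = 0" "q * s - n * h\<^sup>2 - 1 = 0" using b s by simp_all
    have "n * i + r * j = c1 + (n * b - r\<^sup>2 - q) * (c1 * s) + (q * s - n * h\<^sup>2 - 1) * c1"
      "r * i + b * j + h * k = c2 + (n * b - r\<^sup>2 - q) * (c2 * s - c3 * h) + (q * s - n * h\<^sup>2 - 1) * c2"
      "h * j + s * k = c3 + (q * s - n * h\<^sup>2 - 1) * c3"
      unfolding i_def j_def k_def by (simp_all add: algebra_simps power2_eq_square)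
    then have "n * i + r * j = c1" "r * i + b * j + h * k = c2" "h * j + s * k = c3"
      unfolding z by simp_all
    then have "of_int n * of_int i + of_int r * of_int j = (of_int c1 :: real)"
      "of_int r * of_int i + of_int b * of_int j + of_int h * of_int k = (of_int c2 :: real)"
      "of_int h * of_int j + of_int s * of_int k = (of_int c3 :: real)"
      by (simp_all only: of_int_add[symmetric] of_int_mult[symmetric])
    then have "(x - y) \<bullet> v1 = 0" "(x - y) \<bullet> v2 = 0" "(x - y) \<bullet> v3 = 0"
      by (simp_all add: inner_diff_left c y_def inner_add_left inn inn' mult.commute)
    then have "x - y = 0"
      using n q by (cases "x - y") (auto simp: v1_def v2_def v3_def zero_prod_def)
    then have "x = y" by simp
    then show "x \<in> U" unfolding U_def y_def by blast
  qed
  from self_dual_orthonormal_basis[OF this] obtain E where E: "E \<subseteq> U" "orthonormal E" "card E = DIM(real \<times> real \<times> real)"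
    by auto
  then have "card E = 3" by simp
  then obtain e1 e2 e3 where E3: "E = {e1, e2, e3}" "e1 \<noteq> e2" "e1 \<noteq> e3" "e2 \<noteq> e3"
    unfolding card_3_iff by blast
  have "\<forall>e\<in>E. \<exists>k::int. v1 \<bullet> e = of_int k"
    using E(1) vU(1) self_dual_inner_Ints[OF \<open>self_dual U\<close>] by (meson Ints_cases subsetD)
  then obtain k1 k2 k3 :: int where k: "v1 \<bullet> e1 = k1" "v1 \<bullet> e2 = k2" "v1 \<bullet> e3 = k3" using E3 by auto
  have "of_int n = v1 \<bullet> v1" by (simp add: inn)
  also have "\<dots> = of_int (k1\<^sup>2 + k2\<^sup>2 + k3\<^sup>2)"
    using orthonormal_basis_inner[OF E(2,3), of v1 v1] E3 k by (simp add: power2_eq_square)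
  finally have "n = k1\<^sup>2 + k2\<^sup>2 + k3\<^sup>2" by (simp only: of_int_eq_iff)
  then show ?thesis by blast
qed

lemma three_squares_1_mod_4:
  fixes n :: nat
  assumes "n mod 4 = 1"
  shows "\<exists>x y z :: int. int n = x\<^sup>2 + y\<^sup>2 + z\<^sup>2"
proof -
  define n0 f where "n0 = squarefree_part n" and "f = square_part n"
  have n: "n = n0 * f\<^sup>2" unfolding n0_def f_def by (rule squarefree_decompose)
  have "odd n" using assms by presburger
  then have "odd f" unfolding n by auto
  then have "f\<^sup>2 mod 4 = 1"
    using odd_mod_4[of f] by (auto simp: power2_eq_square mod_mult_eq[symmetric, of f f 4])
  then have "n0 mod 4 = 1"
    using assms unfolding n by (metis mod_mult_right_eq mult.right_neutral)
  moreover have "squarefree n0" by (simp add: n0_def)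
  ultimately obtain q r h :: int where "q > 0" "int n0 dvd r\<^sup>2 + q" "q dvd int n0 * h\<^sup>2 + 1"
    using exists_auxiliary_determinant by blast
  moreover have "n0 > 0" using \<open>odd n\<close> n by (auto intro: Nat.gr0I)
  ultimately obtain x y z :: int where "int n0 = x\<^sup>2 + y\<^sup>2 + z\<^sup>2"
    using three_squares_of_auxiliary[of "int n0" q r h] by auto
  then have "int n = (x * f)\<^sup>2 + (y * f)\<^sup>2 + (z * f)\<^sup>2"
    by (simp add: n power_mult_distrib algebra_simps)
  then show ?thesis by blast
qed

section \<open>Binary forms as sums of five squares of linear forms\<close>

text \<open>Up to factors 4, either \<open>A - 1\<close> or \<open>2 A - 1\<close> is 1 modulo 4 and hence a sum of three
  squares; a factor 2 is removed by \<open>((x + y) / 2)^2 + ((x - y) / 2)^2 = (x^2 + y^2) / 2\<close>.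
  Rational squares suffice because integrality is recovered at the end, for the whole form at
  once.\<close>
lemma rational_four_squares:
  fixes A :: nat
  shows "\<exists>a b c e :: rat. of_nat A = a\<^sup>2 + b\<^sup>2 + c\<^sup>2 + e\<^sup>2"
proof (induction A rule: less_induct)
  case (less A)
  have "A = 0 \<or> A > 0 \<and> A mod 4 = 0 \<or> odd A \<or> A mod 4 = 2" by presburger
  then consider "A = 0" | "A > 0" "A mod 4 = 0" | "odd A" | "A mod 4 = 2" by fastforce
  then show ?case
  proof cases
    case 1
    then show ?thesis by (intro exI[of _ 0]) simp
  next
    case 2
    then obtain A' where A': "A = 4 * A'" by auto
    with 2 have "A' < A" by simp
    then obtain a b c e :: rat where "of_nat A' = a\<^sup>2 + b\<^sup>2 + c\<^sup>2 + e\<^sup>2" using less by blast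
    then have "of_nat A = (2 * a)\<^sup>2 + (2 * b)\<^sup>2 + (2 * c)\<^sup>2 + (2 * e)\<^sup>2" by (simp add: A' power_mult_distrib)
    then show ?thesis by blast
  next
    case 3
    then obtain m where "A = 2 * m + 1" by (auto elim: oddE)
    then have "2 * A - 1 = 1 + 4 * m" by simp
    then have "(2 * A - 1) mod 4 = 1" by (simp only: mod_mult_self2) simp
    then obtain x y z :: int where "int (2 * A - 1) = x\<^sup>2 + y\<^sup>2 + z\<^sup>2" using three_squares_1_mod_4 by blast
    moreover have "1 \<le> 2 * A" using 3 by presburger
    then have "int (2 * A - 1) = 2 * int A - 1" by (simp add: of_nat_diff)
    ultimately have "2 * int A = 1 + x\<^sup>2 + y\<^sup>2 + z\<^sup>2" by linarith
    from arg_cong[OF this, of "of_int :: int \<Rightarrow> rat"]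
    have "2 * of_nat A = (1::rat) + (of_int x)\<^sup>2 + (of_int y)\<^sup>2 + (of_int z)\<^sup>2" by simp
    then have "of_nat A = ((1 + of_int x) / 2)\<^sup>2 + ((1 - of_int x) / 2)\<^sup>2 
        + ((of_int y + of_int z) / 2)\<^sup>2 + ((of_int y - of_int z) / (2::rat))\<^sup>2"
      by (simp add: power2_eq_square field_simps)
    then show ?thesis by blast
  next
    case 4
    then have A: "A = 2 + 4 * (A div 4)" using mod_mult_div_eq[of A 4] by simp
    then have "A - 1 = 1 + 4 * (A div 4)" by linarith
    then have "(A - 1) mod 4 = 1" by (simp only: mod_mult_self2) simp
    then obtain x y z :: int where "int (A - 1) = x\<^sup>2 + y\<^sup>2 + z\<^sup>2" using three_squares_1_mod_4 by blast
    moreover have "A \<ge> 1" using A by linarith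
    ultimately have "int A = 1 + x\<^sup>2 + y\<^sup>2 + z\<^sup>2" by (simp add: of_nat_diff)
    from arg_cong[OF this, of "of_int :: int \<Rightarrow> rat"]
    have "of_nat A = (1::rat)\<^sup>2 + (of_int x)\<^sup>2 + (of_int y)\<^sup>2 + (of_int z)\<^sup>2" by simp
    then show ?thesis by blast
  qed
qed

definition represents :: "nat \<Rightarrow> nat \<Rightarrow> bool" where
  "represents A d \<longleftrightarrow> (\<exists>x p1 p2 p3 :: rat. of_nat d = of_nat A * x\<^sup>2 + p1\<^sup>2 + p2\<^sup>2 + p3\<^sup>2)"

lemma represents_4: "represents A d \<Longrightarrow> represents (4 * A) d" "represents A d \<Longrightarrow> represents A (4 * d)"
proof -
  assume "represents A d"
  then obtain x p1 p2 p3 :: rat where *: "of_nat d = of_nat A * x\<^sup>2 + p1\<^sup>2 + p2\<^sup>2 + p3\<^sup>2"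
    by (auto simp: represents_def)
  have "of_nat d = of_nat (4 * A) * (x / 2)\<^sup>2 + p1\<^sup>2 + p2\<^sup>2 + p3\<^sup>2" 
    "of_nat (4 * d) = of_nat A * (2 * x)\<^sup>2 + (2 * p1)\<^sup>2 + (2 * p2)\<^sup>2 + (2 * p3)\<^sup>2"
    using * by (simp_all add: power_mult_distrib power_divide algebra_simps)
  then show "represents (4 * A) d" "represents A (4 * d)" unfolding represents_def by blast+
qed

text \<open>The source of representations: \<open>x = s / t\<close> and a sum of three squares for the
  numerator of \<open>d - A x^2\<close>.\<close>
lemma represents_of_difference:
  assumes "t > 0" "A * s\<^sup>2 < d * t\<^sup>2" "[int d * (int t)\<^sup>2 - int A * (int s)\<^sup>2 = 1] (mod 4)"
  shows "represents A d"
proof -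
  define n where "n = d * t\<^sup>2 - A * s\<^sup>2"
  have n: "int n = int d * (int t)\<^sup>2 - int A * (int s)\<^sup>2" using assms(2) by (simp add: n_def of_nat_diff)
  then have "int n mod 4 = 1" using assms(3) by (simp add: cong_def)
  then have "n mod 4 = 1" by presburger
  then obtain x y z :: int where "int n = x\<^sup>2 + y\<^sup>2 + z\<^sup>2" using three_squares_1_mod_4 by blast
  then have "int d * (int t)\<^sup>2 = int A * (int s)\<^sup>2 + x\<^sup>2 + y\<^sup>2 + z\<^sup>2" using n by simp
  then have "of_int (int d * (int t)\<^sup>2) = (of_int (int A * (int s)\<^sup>2 + x\<^sup>2 + y\<^sup>2 + z\<^sup>2) :: rat)" by simp
  then have "of_nat d * (of_nat t)\<^sup>2 = of_nat A * (of_nat s)\<^sup>2 + (of_int x)\<^sup>2 + (of_int y)\<^sup>2 + (of_int z :: rat)\<^sup>2"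
    by simp
  then have "of_nat d = of_nat A * (of_nat s / of_nat t)\<^sup>2 + (of_int x / of_nat t)\<^sup>2 
      + (of_int y / of_nat t)\<^sup>2 + (of_int z / of_nat t :: rat)\<^sup>2"
    using assms(1) by (simp add: power_divide field_simps)
  then show ?thesis unfolding represents_def by blast
qed

lemma cong4_odd_square: "odd t \<Longrightarrow> [(int t)\<^sup>2 = 1] (mod 4)"
proof -
  assume "odd t"
  then obtain c where "t = 2 * c + 1" by (auto elim: oddE)
  then have "(int t)\<^sup>2 - 1 = 4 * (int c * int c + int c)" by (simp add: power2_eq_square algebra_simps)
  then show ?thesis unfolding cong_iff_dvd_diff by simp
qed

lemma represents_odd_t:
  assumes "A > 0" "d > 0" "[int d - int A = 1] (mod 4)"
  shows "represents A d"
proof (rule represents_of_difference[of "2 * A + 1" A 1])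
  have "A * 1 < 1 * (2 * A + 1)" by simp
  also have "\<dots> \<le> d * (2 * A + 1)\<^sup>2" using assms by (intro mult_mono) (auto simp: power2_eq_square)
  finally show "A * 1\<^sup>2 < d * (2 * A + 1)\<^sup>2" by simp
  have "[int d * (int (2 * A + 1))\<^sup>2 - int A * (int 1)\<^sup>2 = int d * 1 - int A * 1] (mod 4)"
    by (intro cong_diff cong_mult cong_refl cong4_odd_square) auto
  then show "[int d * (int (2 * A + 1))\<^sup>2 - int A * (int 1)\<^sup>2 = 1] (mod 4)"
    using assms(3) by (metis cong_trans mult.right_neutral)
qed simp

lemma represents_even_t:
  assumes "A mod 4 = 3" "d > 0"
  shows "represents A d"
proof (rule represents_of_difference[of "2 * A" A 1])
  have A: "A > 0" using assms by (auto intro: Nat.gr0I)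
  then show "0 < 2 * A" by simp
  have "A * 1 < 1 * (2 * A)" using A by simp
  also have "\<dots> \<le> d * (2 * A)\<^sup>2" using assms A by (intro mult_mono) (auto simp: power2_eq_square)
  finally show "A * 1\<^sup>2 < d * (2 * A)\<^sup>2" by simp
  have "int d * (int (2 * A))\<^sup>2 - int A * (int 1)\<^sup>2 - 1 = - (int A + 1) + 4 * (int d * (int A)\<^sup>2)"
    by (simp add: power_mult_distrib)
  moreover have "4 dvd int A + 1" using assms(1) by presburger
  ultimately show "[int d * (int (2 * A))\<^sup>2 - int A * (int 1)\<^sup>2 = 1] (mod 4)"
    unfolding cong_iff_dvd_diff by (metis dvd_add dvd_minus_iff dvd_triv_left)
qed

text \<open>Only the residues of \<open>A\<close> and \<open>d\<close> modulo 4 matter, after factors 4 have been removed.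
  With \<open>s = 1\<close>, an odd \<open>t\<close> gives a numerator congruent to \<open>d - A\<close>, an even \<open>t\<close> gives \<open>-A\<close>; for
  \<open>d = 1\<close> modulo 4 one takes \<open>s = 0\<close>. In the two remaining cases, \<open>d = 3\<close>, \<open>A = 1\<close> and
  \<open>d = A = 2\<close>, the number \<open>A d\<close> (up to a factor 4) falls into a case already treated.\<close>
lemma represents_or_swapped:
  assumes "A > 0" "d > 0"
  shows "represents A d \<or> represents (A * d) d"
  using assms
proof (induction "A + d" arbitrary: A d rule: less_induct)
  case less
  have nat_int: "[int d - int A = 1] (mod 4)" if "(int (d mod 4) - int (A mod 4)) mod 4 = 1" for A d :: nat
    using that by (simp add: cong_def zmod_int mod_diff_eq)
  have "A mod 4 = 0 \<or> A mod 4 = 1 \<or> A mod 4 = 2 \<or> A mod 4 = 3" 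
    "d mod 4 = 0 \<or> d mod 4 = 1 \<or> d mod 4 = 2 \<or> d mod 4 = 3" by presburger+
  then consider "4 dvd A" | "4 dvd d" | "d mod 4 = 1" | "d mod 4 = 3" "A mod 4 = 2" | "d mod 4 = 3" "A mod 4 = 3"
    | "d mod 4 = 3" "A mod 4 = 1" | "d mod 4 = 2" "A mod 4 = 1" | "d mod 4 = 2" "A mod 4 = 3"
    | "d mod 4 = 2" "A mod 4 = 2"
    unfolding dvd_eq_mod_eq_0 by argo
  then show ?case
  proof cases
    case 1
    then obtain A' where A': "A = 4 * A'" by auto
    then have "represents A' d \<or> represents (A' * d) d" using less by auto
    then show ?thesis using represents_4(1)[of A' d] represents_4(1)[of "A' * d" d] by (auto simp: A' mult.assoc)
  next
    case 2
    then obtain d' where d': "d = 4 * d'" by auto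
    then have "represents A d' \<or> represents (A * d') d'" using less by auto
    then show ?thesis using represents_4(2)[of A d'] represents_4(2)[OF represents_4(1)[of "A * d'" d']]
      by (auto simp: d' mult.left_commute)
  next
    case 3
    then have "[int d * (int 1)\<^sup>2 - int A * (int 0)\<^sup>2 = 1] (mod 4)" by (simp add: cong_def zmod_int[of d 4, simplified, symmetric])
    then have "represents A d" using less.prems by (intro represents_of_difference[of 1 A 0]) auto
    then show ?thesis ..
  next
    case 4
    then show ?thesis using represents_odd_t[OF less.prems nat_int] by simp
  next
    case 5
    then show ?thesis using represents_even_t less.prems by blast
  next
    case 6
    then have "(A * d) mod 4 = 3" by (metis mod_mult_eq mult_1 mod_mod_trivial)
    then show ?thesis using represents_even_t less.prems by blast
  next
    case 7
    then show ?thesis using represents_odd_t[OF less.prems nat_int] by simp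
  next
    case 8
    then show ?thesis using represents_even_t less.prems by blast
  next
    case 9
    define a b where "a = A div 2" and "b = d div 2"
    have ab: "A = 2 * a" "d = 2 * b" "odd a" "odd b" using 9 unfolding a_def b_def by presburger+
    then have "odd (a * b)" by simp
    then have "(a * b) mod 4 = 1 \<or> (a * b) mod 4 = 3" by presburger
    then have "represents (a * b) d"
    proof
      assume "(a * b) mod 4 = 1"
      then show ?thesis using 9 less.prems ab represents_odd_t[of "a * b" d, OF _ _ nat_int] by auto
    next
      assume "(a * b) mod 4 = 3"
      then show ?thesis using represents_even_t less.prems by blast
    qed
    then have "represents (4 * (a * b)) d" by (rule represents_4)
    moreover have "4 * (a * b) = A * d" using ab by simp
    ultimately show ?thesis by simp
  qed
qed

type_synonym real5 = "real \<times> real \<times> real \<times> real \<times> real"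

lemma Basis_real5_rational:
  fixes a b c d e :: real
  assumes "a \<in> \<rat>" "b \<in> \<rat>" "c \<in> \<rat>" "d \<in> \<rat>" "e \<in> \<rat>"
  shows "\<And>i. i \<in> Basis \<Longrightarrow> (a, b, c, d, e) \<bullet> i \<in> \<rat>"
  using assms by (auto simp: Basis_prod_def)

text \<open>Let \<open>u\<close> be a quaternion of norm \<open>A\<close>. For a pure quaternion \<open>p\<close>, the product \<open>u p\<close> is
  orthogonal to \<open>u\<close> and has norm \<open>A |p|^2\<close>, so the pair \<open>(0, u)\<close>, \<open>(A x, u p)\<close> has squared
  lengths \<open>A\<close> and \<open>A (A x^2 + |p|^2) = A d\<close>. If only \<open>A d\<close> in place of \<open>A\<close> admits a
  representation, the two vectors change roles.\<close>
lemma rational_orthogonal_pair: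
  fixes A d :: nat
  assumes "A > 0" "d > 0"
  shows "\<exists>f g :: real5. f \<bullet> f = A \<and> g \<bullet> g = A * d \<and> f \<bullet> g = 0 \<and>
           (\<forall>i\<in>Basis. f \<bullet> i \<in> \<rat>) \<and> (\<forall>i\<in>Basis. g \<bullet> i \<in> \<rat>)"
proof -
  have core: "\<exists>f g :: real5. f \<bullet> f = A \<and> g \<bullet> g = A * d \<and> f \<bullet> g = 0 \<and>
           (\<forall>i\<in>Basis. f \<bullet> i \<in> \<rat>) \<and> (\<forall>i\<in>Basis. g \<bullet> i \<in> \<rat>)" if rep: "represents A d" for A d :: nat
  proof -
    obtain x' q1 q2 q3 :: rat where d': "of_nat d = of_nat A * x'\<^sup>2 + q1\<^sup>2 + q2\<^sup>2 + q3\<^sup>2"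
      using rep by (auto simp: represents_def)
    obtain a' b' c' e' :: rat where A': "of_nat A = a'\<^sup>2 + b'\<^sup>2 + c'\<^sup>2 + e'\<^sup>2"
      using rational_four_squares by blast
    define x p1 p2 p3 a b c e :: real where "x = of_rat x'" and "p1 = of_rat q1" and "p2 = of_rat q2"
      and "p3 = of_rat q3" and "a = of_rat a'" and "b = of_rat b'" and "c = of_rat c'" and "e = of_rat e'"
    have d: "of_nat d = of_nat A * x\<^sup>2 + p1\<^sup>2 + p2\<^sup>2 + p3\<^sup>2"
      using arg_cong[OF d', of "of_rat :: rat \<Rightarrow> real"]
      by (simp add: x_def p1_def p2_def p3_def of_rat_add of_rat_mult of_rat_power)
    have A: "of_nat A = a\<^sup>2 + b\<^sup>2 + c\<^sup>2 + e\<^sup>2"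
      using arg_cong[OF A', of "of_rat :: rat \<Rightarrow> real"]
      by (simp add: a_def b_def c_def e_def of_rat_add of_rat_power)
    have rats: "x \<in> \<rat>" "p1 \<in> \<rat>" "p2 \<in> \<rat>" "p3 \<in> \<rat>" "a \<in> \<rat>" "b \<in> \<rat>" "c \<in> \<rat>" "e \<in> \<rat>"
      by (simp_all add: x_def p1_def p2_def p3_def a_def b_def c_def e_def)
    \<comment> \<open>The last four coordinates are the quaternion product of a + b i + c j + e k and p1 i + p2 j + p3 k.\<close>
    define g :: real5 where "g = (of_nat A * x, - (b * p1 + c * p2 + e * p3), a * p1 + c * p3 - e * p2,
        a * p2 + e * p1 - b * p3, a * p3 + b * p2 - c * p1)"
    define f :: real5 where "f = (0, a, b, c, e)"
    have "f \<bullet> f = A" unfolding A f_def by (simp add: power2_eq_square)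
    moreover have "f \<bullet> g = 0" unfolding f_def g_def by (simp add: algebra_simps)
    moreover have "g \<bullet> g = A * d"
    proof -
      have "g \<bullet> g = (of_nat A * x)\<^sup>2 + (a\<^sup>2 + b\<^sup>2 + c\<^sup>2 + e\<^sup>2) * (p1\<^sup>2 + p2\<^sup>2 + p3\<^sup>2)"
        unfolding g_def by (simp add: power2_eq_square algebra_simps)
      also have "\<dots> = of_nat A * of_nat d"
        unfolding A[symmetric] d by (simp add: power2_eq_square algebra_simps)
      finally show ?thesis by simp
    qed
    moreover have "\<forall>i\<in>Basis. f \<bullet> i \<in> \<rat>" "\<forall>i\<in>Basis. g \<bullet> i \<in> \<rat>"
      unfolding f_def g_def using rats by (intro ballI Basis_real5_rational; simp)+
    ultimately show ?thesis by blast
  qed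
  show ?thesis
  proof (cases "represents A d")
    case True
    then show ?thesis by (rule core)
  next
    case False
    then have "represents (A * d) d" using represents_or_swapped[OF assms] by blast
    from core[OF this] obtain f g :: real5 where fg: "f \<bullet> f = A * d" "g \<bullet> g = A * d * d" "f \<bullet> g = 0"
      "\<forall>i\<in>Basis. f \<bullet> i \<in> \<rat>" "\<forall>i\<in>Basis. g \<bullet> i \<in> \<rat>" unfolding of_nat_mult by blast
    define h where "h = g /\<^sub>R of_nat d"
    have "h \<bullet> h = A" "h \<bullet> f = 0"
      using fg(2,3) assms by (simp_all add: h_def inner_commute[of g f] field_simps)
    moreover have "\<forall>i\<in>Basis. h \<bullet> i \<in> \<rat>" using fg(5) by (simp add: h_def)
    ultimately show ?thesis using fg by blast
  qed
qed

text \<open>Mordell's theorem. For \<open>A > 0\<close> and \<open>d = A C - B^2 > 0\<close> the form is rationally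
  equivalent to the diagonal form with entries \<open>A\<close> and \<open>A d\<close>, which \<open>rational_orthogonal_pair\<close>
  realises in dimension 5; the vector \<open>w\<close> undoes the diagonalisation. In the degenerate cases
  the two vectors are proportional.\<close>
lemma five_squares_binary:
  fixes A B C :: int
  assumes A: "A \<ge> 0" and C: "C \<ge> 0" and AC: "B\<^sup>2 \<le> A * C"
  shows "\<exists>L :: (int \<times> int) list. length L = 5 \<and> A = (\<Sum>(u, v)\<leftarrow>L. u\<^sup>2) \<and> 
           B = (\<Sum>(u, v)\<leftarrow>L. u * v) \<and> C = (\<Sum>(u, v)\<leftarrow>L. v\<^sup>2)"
proof -
  have single: "\<exists>f :: real5. f \<bullet> f = of_nat k \<and> (\<forall>i\<in>Basis. f \<bullet> i \<in> \<rat>)" for k :: nat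
  proof -
    obtain a b c e :: rat where "of_nat k = a\<^sup>2 + b\<^sup>2 + c\<^sup>2 + e\<^sup>2" using rational_four_squares by blast
    from arg_cong[OF this, of "of_rat :: rat \<Rightarrow> real"] 
    have "of_nat k = (of_rat a)\<^sup>2 + (of_rat b)\<^sup>2 + (of_rat c)\<^sup>2 + (of_rat e :: real)\<^sup>2"
      by (simp add: of_rat_add of_rat_power)
    then have "((0, of_rat a, of_rat b, of_rat c, of_rat e) :: real5) \<bullet> (0, of_rat a, of_rat b, of_rat c, of_rat e) = of_nat k"
      by (simp add: power2_eq_square)
    moreover have "\<forall>i\<in>Basis. ((0, of_rat a, of_rat b, of_rat c, of_rat e) :: real5) \<bullet> i \<in> \<rat>"
      by (intro ballI Basis_real5_rational) auto
    ultimately show ?thesis by blast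
  qed
  have "\<exists>v w :: real5. v \<bullet> v = of_int A \<and> v \<bullet> w = of_int B \<and> w \<bullet> w = of_int C \<and>
      (\<forall>i\<in>Basis. v \<bullet> i \<in> \<rat>) \<and> (\<forall>i\<in>Basis. w \<bullet> i \<in> \<rat>)"
  proof (cases "A = 0")
    case True
    then have "B = 0" using AC by simp
    obtain w :: real5 where "w \<bullet> w = of_nat (nat C)" "\<forall>i\<in>Basis. w \<bullet> i \<in> \<rat>" using single by blast
    then show ?thesis using True \<open>B = 0\<close> C by (intro exI[of _ 0] exI[of _ w]) auto
  next
    case False
    with A have Apos: "A > 0" by simp
    define d where "d = A * C - B\<^sup>2"
    have "\<exists>f g :: real5. f \<bullet> f = of_int A \<and> g \<bullet> g = of_int A * of_int d \<and> f \<bullet> g = 0 \<and>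
           (\<forall>i\<in>Basis. f \<bullet> i \<in> \<rat>) \<and> (\<forall>i\<in>Basis. g \<bullet> i \<in> \<rat>)"
    proof (cases "d = 0")
      case True
      obtain f :: real5 where "f \<bullet> f = of_nat (nat A)" "\<forall>i\<in>Basis. f \<bullet> i \<in> \<rat>" using single by blast
      then show ?thesis using True Apos by (intro exI[of _ f] exI[of _ 0]) auto
    next
      case False
      with AC have "d > 0" by (simp add: d_def)
      then show ?thesis using rational_orthogonal_pair[of "nat A" "nat d"] Apos by simp
    qed
    then obtain f g :: real5 where fg: "f \<bullet> f = of_int A" "g \<bullet> g = of_int A * of_int d" "f \<bullet> g = 0"
      "\<And>i. i \<in> Basis \<Longrightarrow> f \<bullet> i \<in> \<rat>" "\<And>i. i \<in> Basis \<Longrightarrow> g \<bullet> i \<in> \<rat>" by blast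
    define w where "w = (g + of_int B *\<^sub>R f) /\<^sub>R of_int A"
    have "f \<bullet> w = of_int B" using fg Apos by (simp add: w_def inner_add_right field_simps)
    moreover have "w \<bullet> w = of_int C"
    proof -
      have "w \<bullet> w = (of_int d + (of_int B)\<^sup>2) / of_int A"
        using fg Apos by (simp add: w_def inner_add_left inner_add_right inner_commute[of g f] power2_eq_square field_simps)
      also have "of_int d + (of_int B)\<^sup>2 = (of_int A * of_int C :: real)" by (simp add: d_def)
      finally show ?thesis using Apos by simp
    qed
    moreover have "w \<bullet> i \<in> \<rat>" if "i \<in> Basis" for i
      using fg(4,5)[OF that] by (simp add: w_def inner_add_left)
    ultimately show ?thesis using fg by blast
  qed
  then obtain v w :: real5 where vw: "v \<bullet> v = of_int A" "v \<bullet> w = of_int B" "w \<bullet> w = of_int C"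
      "\<And>i. i \<in> Basis \<Longrightarrow> v \<bullet> i \<in> \<rat>" "\<And>i. i \<in> Basis \<Longrightarrow> w \<bullet> i \<in> \<rat>" by blast
  obtain E :: "real5 set" and f g where E: "finite E" "card E = DIM(real5)" "v \<bullet> v = of_int (\<Sum>e\<in>E. (f e)\<^sup>2)"
    "v \<bullet> w = of_int (\<Sum>e\<in>E. f e * g e)" "w \<bullet> w = of_int (\<Sum>e\<in>E. (g e)\<^sup>2)"
    using rational_vectors_integral_coordinates[of v w] vw by auto
  obtain es where es: "set es = E" "distinct es" using finite_distinct_list[OF E(1)] by blast
  have "length es = 5" using distinct_card[OF es(2)] es(1) E(2) by simp
  moreover have "A = (\<Sum>e\<in>E. (f e)\<^sup>2)" "B = (\<Sum>e\<in>E. f e * g e)" "C = (\<Sum>e\<in>E. (g e)\<^sup>2)"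
    using E(3-5) unfolding vw of_int_eq_iff by simp_all
  ultimately show ?thesis
    unfolding es(1)[symmetric] sum_list_distinct_conv_sum_set[OF es(2), symmetric]
    by (intro exI[of _ "map (\<lambda>e. (f e, g e)) es"]) (simp add: o_def)
qed

section \<open>Integers and total positivity in a real quadratic field\<close>

lemma sqrt_squarefree_irrational:
  fixes D :: int
  assumes "D \<ge> 2" "squarefree D"
  shows "sqrt (of_int D) \<notin> \<rat>"
proof
  assume "sqrt (of_int D) \<in> \<rat>"
  moreover have "algebraic_int (sqrt (of_int D))"
    by (intro algebraic_int_sqrt int_imp_algebraic_int) auto
  ultimately have "sqrt (of_int D) \<in> \<int>" by (rule rational_algebraic_int_is_int[rotated])
  then obtain k where k: "sqrt (of_int D) = of_int k" by (auto elim: Ints_cases)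
  have "of_int D = (of_int k :: real)\<^sup>2" unfolding k[symmetric] using assms(1) by simp
  then have "D = k\<^sup>2" by (simp only: of_int_power[symmetric] of_int_eq_iff)
  then have "k dvd 1" using assms(2) squarefreeD[of D k] by simp
  then have "D = 1" using \<open>D = k\<^sup>2\<close> by (auto simp: abs_if split: if_splits)
  with assms show False by simp
qed

locale real_quadratic =
  fixes D :: int and s :: real
  assumes D: "D \<ge> 2" "squarefree D" and s_def: "s = sqrt (of_int D)"
begin

lemma s_sq: "s * s = of_int D" and s_pos: "s > 0"
  using D by (auto simp: s_def)

lemma coordinates_unique:
  assumes "of_rat a + of_rat b * s = of_rat c + of_rat d * s"
  shows "a = c" "b = d"
proof -
  have *: "of_rat (b - d) * s = of_rat (c - a)" using assms by (simp add: of_rat_diff algebra_simps)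
  show "b = d"
  proof (rule ccontr)
    assume "b \<noteq> d"
    then have "s = of_rat ((c - a) / (b - d))" using * by (simp add: of_rat_divide field_simps)
    then have "s \<in> \<rat>" by simp
    then show False using sqrt_squarefree_irrational[OF D] by (simp add: s_def)
  qed
  then show "a = c" using assms by simp
qed

lemma int_coordinates_unique:
  fixes a b c d :: int
  assumes "of_int a + of_int b * s = of_int c + of_int d * s"
  shows "a = c" "b = d"
  using coordinates_unique[of "of_int a" "of_int b" "of_int c" "of_int d"] assms by simp_all

lemma power_conjugate:
  "\<exists>A B. (of_rat a + of_rat b * s) ^ k = of_rat A + of_rat B * s \<and>
         (of_rat a - of_rat b * s) ^ k = of_rat A - of_rat B * s"
proof (induction k)
  case 0
  show ?case by (intro exI[of _ 1] exI[of _ 0]) simp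
next
  case (Suc k)
  then obtain A B where AB: "(of_rat a + of_rat b * s) ^ k = of_rat A + of_rat B * s"
    "(of_rat a - of_rat b * s) ^ k = of_rat A - of_rat B * s" by blast
  have "(of_rat a + of_rat b * s) ^ Suc k = of_rat (a * A + of_int D * b * B) + of_rat (a * B + b * A) * s"
    "(of_rat a - of_rat b * s) ^ Suc k = of_rat (a * A + of_int D * b * B) - of_rat (a * B + b * A) * s"
    unfolding power_Suc AB by (simp_all add: of_rat_add of_rat_mult algebra_simps flip: s_sq)
  then show ?case by blast
qed

text \<open>All powers of \<open>y\<close> have coordinates with a common denominator. For elements of the
  field this is equivalent to being an algebraic integer, and it is inherited by \<open>y + 1\<close> and
  by the norm in an obvious way. It gives the integrality of the norm and, through the norm of
  \<open>y + 1\<close>, of the trace.\<close>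
definition bounded_powers :: "real \<Rightarrow> bool" where
  "bounded_powers y \<longleftrightarrow> (\<exists>N>0. \<forall>k. \<exists>u v :: int. of_nat N * y ^ k = of_int u + of_int v * s)"

lemma bounded_powers_algebraic_int:
  assumes x: "x = of_rat a + of_rat b * s" "algebraic_int x"
  shows "bounded_powers x"
proof -
  obtain p where p: "lead_coeff p = 1" "\<And>i. Polynomial.coeff p i \<in> \<int>" "poly p x = 0"
    using x(2) by (auto elim!: algebraic_int.cases)
  define n where "n = Polynomial.degree p"
  have "(\<Sum>i<n. Polynomial.coeff p i * x ^ i) + x ^ n = 0"
    using p(1,3) unfolding poly_altdef n_def lessThan_Suc_atMost[symmetric] by simp
  then have xn: "x ^ n = - (\<Sum>i<n. Polynomial.coeff p i * x ^ i)" by linarith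
  have "\<exists>A B. x ^ k = of_rat A + of_rat B * s" for k
    using power_conjugate[of a b k] x(1) by blast
  then obtain A B where AB: "\<And>k. x ^ k = of_rat (A k) + of_rat (B k) * s" by metis
  obtain N1 where N1: "N1 > 0" "\<And>i. i < n \<Longrightarrow> of_nat N1 * of_rat (A i) \<in> (\<int> :: real set)"
    using common_denominator[of "{..<n}" "\<lambda>i. of_rat (A i)"] by auto
  obtain N2 where N2: "N2 > 0" "\<And>i. i < n \<Longrightarrow> of_nat N2 * of_rat (B i) \<in> (\<int> :: real set)"
    using common_denominator[of "{..<n}" "\<lambda>i. of_rat (B i)"] by auto
  have "\<exists>u v :: int. of_nat (N1 * N2) * x ^ k = of_int u + of_int v * s" for k
  proof (induction k rule: less_induct)
    case (less k)
    show ?case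
    proof (cases "k < n")
      case True
      obtain u v :: int where "of_nat N1 * of_rat (A k) = (of_int u :: real)" "of_nat N2 * of_rat (B k) = (of_int v :: real)"
        using N1(2)[OF True] N2(2)[OF True] by (auto elim!: Ints_cases)
      then have "of_nat (N1 * N2) * x ^ k = of_int (int N2 * u) + of_int (int N1 * v) * s"
        unfolding AB by (simp add: algebra_simps)
      then show ?thesis by blast
    next
      case False
      have "\<forall>i<n. \<exists>u v :: int. of_nat (N1 * N2) * x ^ (k - n + i) = of_int u + of_int v * s"
      proof (intro allI impI less)
        fix i assume "i < n"
        then show "k - n + i < k" using False by simp
      qed
      then obtain u v :: "nat \<Rightarrow> int" where uv: "\<And>i. i < n \<Longrightarrow> of_nat (N1 * N2) * x ^ (k - n + i) = of_int (u i) + of_int (v i) * s"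
        by metis
      have "\<forall>i. \<exists>z :: int. Polynomial.coeff p i = of_int z" using p(2) by (meson Ints_cases)
      then obtain c :: "nat \<Rightarrow> int" where c: "\<And>i. Polynomial.coeff p i = of_int (c i)" by metis
      have "of_nat (N1 * N2) * x ^ k = of_nat (N1 * N2) * (x ^ (k - n) * x ^ n)"
        using False by (simp flip: power_add)
      also have "\<dots> = - (\<Sum>i<n. of_int (c i) * (of_nat (N1 * N2) * x ^ (k - n + i)))"
        unfolding xn c by (simp add: sum_distrib_left power_add algebra_simps)
      also have "\<dots> = of_int (- (\<Sum>i<n. c i * u i)) + of_int (- (\<Sum>i<n. c i * v i)) * s"
        using uv by (simp add: sum.distrib sum_distrib_left sum_distrib_right algebra_simps)
      finally show ?thesis by blast
    qed
  qed
  then show ?thesis unfolding bounded_powers_def using N1 N2 by (intro exI[of _ "N1 * N2"]) auto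
qed

lemma bounded_powers_add_1:
  assumes "bounded_powers x"
  shows "bounded_powers (x + 1)"
proof -
  obtain N u v where N: "N > 0" "\<And>k. of_nat N * x ^ k = of_int (u k) + of_int (v k) * s"
    using assms unfolding bounded_powers_def by metis
  have "of_nat N * (x + 1) ^ k = of_int (\<Sum>i\<le>k. int (k choose i) * u i) + of_int (\<Sum>i\<le>k. int (k choose i) * v i) * s" for k
  proof -
    have "of_nat N * (x + 1) ^ k = (\<Sum>i\<le>k. of_nat (k choose i) * (of_nat N * x ^ i))"
      by (subst binomial_ring) (simp add: sum_distrib_left mult_ac)
    also have "\<dots> = of_int (\<Sum>i\<le>k. int (k choose i) * u i) + of_int (\<Sum>i\<le>k. int (k choose i) * v i) * s"
      unfolding N(2) by (simp add: sum.distrib sum_distrib_left sum_distrib_right algebra_simps)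
    finally show ?thesis .
  qed
  then show ?thesis unfolding bounded_powers_def using N(1) by blast
qed

lemma rat_int_of_bounded_powers:
  fixes t :: rat
  assumes "N > 0" "\<And>k. of_nat N * t ^ k \<in> \<int>"
  shows "t \<in> \<int>"
proof -
  obtain p q where pq: "quotient_of t = (p, q)" by fastforce
  then have q: "q > 0" "coprime p q" "t = of_int p / of_int q"
    by (auto simp: quotient_of_denom_pos quotient_of_coprime quotient_of_div)
  have dvd: "q ^ k dvd int N" for k
  proof -
    obtain z where "of_nat N * t ^ k = of_int z" using assms(2) by (auto elim: Ints_cases)
    then have "of_int (int N * p ^ k) = (of_int (z * q ^ k) :: rat)"
      using q by (simp add: power_divide field_simps)
    then have "int N * p ^ k = z * q ^ k" by (simp only: of_int_eq_iff)
    then have "q ^ k dvd int N * p ^ k" by simp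
    moreover have "coprime (q ^ k) (p ^ k)" using q(2) by (simp add: coprime_commute)
    ultimately show ?thesis by (simp add: coprime_dvd_mult_left_iff)
  qed
  have "q = 1"
  proof (rule ccontr)
    assume "q \<noteq> 1"
    with q have "2 \<le> q" by simp
    then have "2 ^ N \<le> q ^ N" by (intro power_mono) auto
    also have "\<dots> \<le> int N" using dvd[of N] assms(1) by (intro zdvd_imp_le) auto
    finally have "int (2 ^ N) \<le> int N" by simp
    then have "2 ^ N \<le> N" by (simp only: of_nat_le_iff)
    then show False using less_exp[of N] by simp
  qed
  then show ?thesis using q by simp
qed

lemma norm_int_of_bounded_powers:
  assumes "bounded_powers (of_rat a + of_rat b * s)"
  shows "a\<^sup>2 - of_int D * b\<^sup>2 \<in> \<int>"
proof -
  obtain N u v where N: "N > 0" "\<And>k. of_nat N * (of_rat a + of_rat b * s) ^ k = of_int (u k) + of_int (v k) * s"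
    using assms unfolding bounded_powers_def by metis
  have "of_nat (N\<^sup>2) * (a\<^sup>2 - of_int D * b\<^sup>2) ^ k \<in> \<int>" for k
  proof -
    obtain A B where AB: "(of_rat a + of_rat b * s) ^ k = of_rat A + of_rat B * s"
      "(of_rat a - of_rat b * s) ^ k = of_rat A - of_rat B * s" using power_conjugate by blast
    have "of_rat (of_nat N * A) + of_rat (of_nat N * B) * s = of_rat (of_int (u k)) + of_rat (of_int (v k)) * s"
      using N(2)[of k] unfolding AB by (simp add: of_rat_mult algebra_simps)
    from coordinates_unique[OF this] have uv: "of_nat N * A = of_int (u k)" "of_nat N * B = of_int (v k)" .
    have "of_rat ((a\<^sup>2 - of_int D * b\<^sup>2) ^ k) = ((of_rat a + of_rat b * s) * (of_rat a - of_rat b * s)) ^ k"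
      by (simp add: of_rat_power of_rat_diff of_rat_mult power2_eq_square algebra_simps flip: s_sq)
    also have "\<dots> = (of_rat A + of_rat B * s) * (of_rat A - of_rat B * s)"
      unfolding power_mult_distrib AB ..
    also have "\<dots> = of_rat (A\<^sup>2 - of_int D * B\<^sup>2)"
      by (simp add: of_rat_power of_rat_diff of_rat_mult power2_eq_square algebra_simps flip: s_sq)
    finally have "(a\<^sup>2 - of_int D * b\<^sup>2) ^ k = A\<^sup>2 - of_int D * B\<^sup>2" by (simp only: of_rat_eq_iff)
    then have "of_nat (N\<^sup>2) * (a\<^sup>2 - of_int D * b\<^sup>2) ^ k = of_nat (N\<^sup>2) * (A\<^sup>2 - of_int D * B\<^sup>2)" by simp
    also have "\<dots> = (of_nat N * A)\<^sup>2 - of_int D * (of_nat N * B)\<^sup>2"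
      by (simp add: power_mult_distrib algebra_simps)
    also have "\<dots> = of_int ((u k)\<^sup>2 - D * (v k)\<^sup>2)" unfolding uv by simp
    finally show ?thesis by simp
  qed
  then show ?thesis by (rule rat_int_of_bounded_powers[rotated]) (use N(1) in simp)
qed

definition integer_parity :: "int \<Rightarrow> int \<Rightarrow> bool" where
  "integer_parity u v \<longleftrightarrow> (if D mod 4 = 1 then even (u - v) else even u \<and> even v)"

text \<open>The divisibility says that \<open>(u + v s) / 2\<close> has integral norm. Squares are 0 or 1
  modulo 4, and \<open>D\<close> is not divisible by 4.\<close>
lemma integer_parity_iff: "integer_parity u v \<longleftrightarrow> 4 dvd u\<^sup>2 - D * v\<^sup>2"
proof -
  have sq: "x\<^sup>2 mod 4 = (if even x then 0 else 1)" for x :: int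
  proof (cases "even x")
    case True
    then obtain k where "x = 2 * k" by (auto elim: evenE)
    then have "x\<^sup>2 = 4 * k\<^sup>2" by (simp add: power_mult_distrib)
    then show ?thesis using True by simp
  next
    case False
    then obtain k where "x = 2 * k + 1" by (auto elim: oddE)
    then have "x\<^sup>2 = 1 + 4 * (k * k + k)" by (simp add: power2_eq_square algebra_simps)
    then have "x\<^sup>2 mod 4 = 1" by (simp only: mod_mult_self2) simp
    then show ?thesis using False by simp
  qed
  have "\<not> 2\<^sup>2 dvd D" using squarefreeD[OF D(2), of 2] by auto
  then have "D mod 4 = 1 \<or> D mod 4 = 2 \<or> D mod 4 = 3" by (simp add: dvd_eq_mod_eq_0) presburger
  moreover have "[u\<^sup>2 - D * v\<^sup>2 = u\<^sup>2 mod 4 - (D mod 4) * (v\<^sup>2 mod 4)] (mod 4)"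
    by (intro cong_diff cong_mult) (simp_all add: cong_def)
  then have "4 dvd u\<^sup>2 - D * v\<^sup>2 \<longleftrightarrow> 4 dvd u\<^sup>2 mod 4 - (D mod 4) * (v\<^sup>2 mod 4)"
    by (rule cong_dvd_iff)
  ultimately show ?thesis
    unfolding sq integer_parity_def by (elim disjE) simp_all
qed

lemma ring_of_integers_iff:
  "x \<in> ring_of_integers (quad_field D) \<longleftrightarrow>
     (\<exists>u v :: int. x = (of_int u + of_int v * s) / 2 \<and> integer_parity u v)"
proof
  assume "x \<in> ring_of_integers (quad_field D)"
  then obtain a b where x: "x = of_rat a + of_rat b * s" "algebraic_int x"
    by (auto simp: ring_of_integers_def quad_field_def s_def)
  note bp = bounded_powers_algebraic_int[OF x]
  then have "a\<^sup>2 - of_int D * b\<^sup>2 \<in> \<int>" unfolding x(1) by (rule norm_int_of_bounded_powers)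
  then obtain n where n: "a\<^sup>2 - of_int D * b\<^sup>2 = of_int n" by (auto elim: Ints_cases)
  have "bounded_powers (of_rat (a + 1) + of_rat b * s)"
    using bounded_powers_add_1[OF bp] unfolding x(1) by (simp add: of_rat_add algebra_simps)
  then have "(a + 1)\<^sup>2 - of_int D * b\<^sup>2 \<in> \<int>" by (rule norm_int_of_bounded_powers)
  then obtain n' where n': "(a + 1)\<^sup>2 - of_int D * b\<^sup>2 = of_int n'" by (auto elim: Ints_cases)
  define u where "u = n' - n - 1"
  have u: "2 * a = of_int u" using n n' by (simp add: u_def power2_eq_square algebra_simps)
  obtain p q where pq: "quotient_of (2 * b) = (p, q)" by fastforce
  then have q: "q > 0" "coprime p q" "2 * b = of_int p / of_int q"
    by (auto simp: quotient_of_denom_pos quotient_of_coprime quotient_of_div)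
  have Db: "of_int D * (2 * b)\<^sup>2 = of_int (u\<^sup>2 - 4 * n)"
    using n u by (simp add: power_mult_distrib flip: u)
  then have "of_int D * (of_int p)\<^sup>2 = (of_int (u\<^sup>2 - 4 * n) * (of_int q)\<^sup>2 :: rat)"
    using q(1) unfolding q(3) by (simp only: power_divide) (simp add: field_simps)
  then have "of_int (D * p\<^sup>2) = (of_int ((u\<^sup>2 - 4 * n) * q\<^sup>2) :: rat)" by simp
  then have "D * p\<^sup>2 = (u\<^sup>2 - 4 * n) * q\<^sup>2" by (simp only: of_int_eq_iff)
  then have "q\<^sup>2 dvd D * p\<^sup>2" by simp
  moreover have "coprime (q\<^sup>2) (p\<^sup>2)" using q(2) by (simp add: coprime_commute)
  ultimately have "q\<^sup>2 dvd D" by (simp add: coprime_dvd_mult_left_iff)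
  then have "q dvd 1" by (rule squarefreeD[OF D(2)])
  then have "q = 1" using q(1) by simp
  then have b: "2 * b = of_int p" using q(3) by simp
  have "of_int (u\<^sup>2 - D * p\<^sup>2) = (of_int (4 * n) :: rat)" using Db unfolding b by simp
  then have up: "u\<^sup>2 - D * p\<^sup>2 = 4 * n" by (simp only: of_int_eq_iff)
  then have "integer_parity u p" unfolding integer_parity_iff by simp
  moreover have "x = (of_int u + of_int p * s) / 2"
  proof -
    have "of_rat (2 * a) = (of_int u :: real)" "of_rat (2 * b) = (of_int p :: real)" unfolding u b by simp_all
    then show ?thesis unfolding x(1) by (simp add: of_rat_mult field_simps)
  qed
  ultimately show "\<exists>u v :: int. x = (of_int u + of_int v * s) / 2 \<and> integer_parity u v" by blast
next
  assume "\<exists>u v :: int. x = (of_int u + of_int v * s) / 2 \<and> integer_parity u v"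
  then obtain u v :: int where x: "x = (of_int u + of_int v * s) / 2" and uv: "integer_parity u v" by blast
  then have "4 dvd u\<^sup>2 - D * v\<^sup>2" by (simp add: integer_parity_iff)
  then obtain n where n: "u\<^sup>2 - D * v\<^sup>2 = 4 * n" by (auto elim: dvdE)
  have "algebraic_int x"
  proof (rule algebraic_int.intros[of "[:of_int n, - of_int u, 1:]"])
    show "\<forall>i. Polynomial.coeff [:of_int n, - of_int u, 1:] i \<in> (\<int> :: real set)"
      by (auto simp: coeff_pCons split: nat.splits)
    have "of_int (4 * n) = (of_int u)\<^sup>2 - (of_int D * (of_int v)\<^sup>2 :: real)"
      unfolding n[symmetric] by simp
    then have "of_int n = ((of_int u)\<^sup>2 - (s * s) * (of_int v)\<^sup>2) / (4 :: real)" unfolding s_sq by simp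
    then show "poly [:of_int n, - of_int u, 1:] x = 0"
      unfolding x by (simp add: power2_eq_square field_simps)
  qed auto
  moreover have "x = of_rat (of_int u / 2) + of_rat (of_int v / 2) * s"
    unfolding x by (simp add: of_rat_divide field_simps)
  ultimately show "x \<in> ring_of_integers (quad_field D)"
    by (auto simp: ring_of_integers_def quad_field_def s_def)
qed

definition conjugate :: "real \<Rightarrow> real" where
  "conjugate x = (THE y. \<exists>a b. x = of_rat a + of_rat b * s \<and> y = of_rat a - of_rat b * s)"

lemma conjugate_eq: "conjugate (of_rat a + of_rat b * s) = of_rat a - of_rat b * s"
  unfolding conjugate_def by (rule the_equality) (auto dest: coordinates_unique)

text \<open>The identity and the conjugation are embeddings. Conversely, an embedding fixes the
  rationals, and \<open>s\<close> can only go to a square root of \<open>D\<close>.\<close>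
lemma totally_positive_iff:
  "totally_positive (quad_field D) (of_rat a + of_rat b * s) \<longleftrightarrow>
     of_rat a + of_rat b * s > 0 \<and> of_rat a - of_rat b * s > 0"
proof
  assume tp: "totally_positive (quad_field D) (of_rat a + of_rat b * s)"
  have "real_embedding (quad_field D) (\<lambda>x. x)" by (simp add: real_embedding_def)
  moreover have "real_embedding (quad_field D) conjugate"
    unfolding real_embedding_def
  proof (intro conjI ballI)
    show "conjugate 1 = 1" using conjugate_eq[of 1 0] by simp
    fix x y assume "x \<in> quad_field D" "y \<in> quad_field D"
    then obtain a b c d where xy: "x = of_rat a + of_rat b * s" "y = of_rat c + of_rat d * s"
      by (auto simp: quad_field_def s_def)
    have "x + y = of_rat (a + c) + of_rat (b + d) * s" unfolding xy by (simp add: of_rat_add algebra_simps)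
    then have "conjugate (x + y) = of_rat (a + c) - of_rat (b + d) * s" by (simp only: conjugate_eq)
    then show "conjugate (x + y) = conjugate x + conjugate y"
      unfolding xy conjugate_eq by (simp add: of_rat_add algebra_simps)
    have "x * y = of_rat (a * c + of_int D * b * d) + of_rat (a * d + b * c) * s"
      unfolding xy by (simp add: of_rat_add of_rat_mult algebra_simps flip: s_sq)
    then have "conjugate (x * y) = of_rat (a * c + of_int D * b * d) - of_rat (a * d + b * c) * s"
      by (simp only: conjugate_eq)
    then show "conjugate (x * y) = conjugate x * conjugate y"
      unfolding xy conjugate_eq by (simp add: of_rat_add of_rat_mult algebra_simps flip: s_sq)
  qed
  ultimately show "of_rat a + of_rat b * s > 0 \<and> of_rat a - of_rat b * s > 0"
    using tp unfolding totally_positive_def by (metis conjugate_eq)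
next
  assume pos: "of_rat a + of_rat b * s > 0 \<and> of_rat a - of_rat b * s > 0"
  show "totally_positive (quad_field D) (of_rat a + of_rat b * s)"
    unfolding totally_positive_def
  proof (intro allI impI)
    fix \<sigma> assume "real_embedding (quad_field D) \<sigma>"
    then have one: "\<sigma> 1 = 1" and add: "\<And>x y. x \<in> quad_field D \<Longrightarrow> y \<in> quad_field D \<Longrightarrow> \<sigma> (x + y) = \<sigma> x + \<sigma> y"
      and mult: "\<And>x y. x \<in> quad_field D \<Longrightarrow> y \<in> quad_field D \<Longrightarrow> \<sigma> (x * y) = \<sigma> x * \<sigma> y"
      by (auto simp: real_embedding_def)
    have ratK: "of_rat r \<in> quad_field D" for r unfolding quad_field_def by (force intro: exI[of _ 0])
    have "of_rat 0 + of_rat 1 * s \<in> quad_field D" unfolding quad_field_def s_def by blast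
    then have sK: "s \<in> quad_field D" by simp
    have "of_rat 0 + of_rat b * s \<in> quad_field D" unfolding quad_field_def s_def by blast
    then have bsK: "of_rat b * s \<in> quad_field D" by simp
    have addr: "\<sigma> (of_rat (x + y)) = \<sigma> (of_rat x) + \<sigma> (of_rat y)" for x y
      unfolding of_rat_add by (rule add[OF ratK ratK])
    have multr: "\<sigma> (of_rat (x * y)) = \<sigma> (of_rat x) * \<sigma> (of_rat y)" for x y
      unfolding of_rat_mult by (rule mult[OF ratK ratK])
    have zero: "\<sigma> (of_rat 0) = 0" using addr[of 0 0] by simp
    have nat: "\<sigma> (of_rat (of_nat k)) = of_nat k" for k
    proof (induction k)
      case 0
      show ?case using zero by simp
    next
      case (Suc k)
      have "\<sigma> (of_rat (of_nat k + 1)) = of_nat k + 1" unfolding addr Suc using one by simp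
      then show ?case by (simp add: add.commute)
    qed
    have int: "\<sigma> (of_rat (of_int z)) = of_int z" for z
    proof (cases "z \<ge> 0")
      case True
      then show ?thesis using nat[of "nat z"] by simp
    next
      case False
      have "\<sigma> (of_rat (of_int z + of_nat (nat (- z)))) = 0" using False zero by simp
      then show ?thesis unfolding addr nat using False by simp
    qed
    have rat: "\<sigma> (of_rat r) = of_rat r" for r
    proof -
      obtain p q where "quotient_of r = (p, q)" by fastforce
      then have q: "q > 0" "r = of_int p / of_int q" by (auto simp: quotient_of_denom_pos quotient_of_div)
      then have "of_int p = of_int q * r" by simp
      then have "of_int p = of_int q * \<sigma> (of_rat r)" using int[of p] int[of q] multr[of "of_int q" r] by simp
      then have "\<sigma> (of_rat r) = of_int p / of_int q" using q(1) by (metis nonzero_mult_div_cancel_left of_int_0_eq_iff order_less_irrefl)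
      also have "\<dots> = of_rat r" by (simp add: q(2) of_rat_divide)
      finally show ?thesis .
    qed
    have "\<sigma> s * \<sigma> s = of_int D" using mult[OF sK sK] rat[of "of_int D"] unfolding s_sq by simp
    then have "\<sigma> s * \<sigma> s = s * s" by (simp add: s_sq)
    then have "\<sigma> s = s \<or> \<sigma> s = - s" by (simp add: square_eq_iff)
    moreover have "\<sigma> (of_rat a + of_rat b * s) = of_rat a + of_rat b * \<sigma> s"
      using add[OF ratK bsK] mult[OF ratK sK] rat by simp
    ultimately show "\<sigma> (of_rat a + of_rat b * s) > 0" using pos by auto
  qed
qed

lemma totally_positive_integers_iff:
  "x \<in> totally_positive_integers (quad_field D) \<longleftrightarrow>
     (\<exists>u v :: int. x = (of_int u + of_int v * s) / 2 \<and> integer_parity u v \<and>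
        of_int u + of_int v * s > 0 \<and> of_int u - of_int v * s > 0)"
proof -
  have "totally_positive (quad_field D) ((of_int u + of_int v * s) / 2) \<longleftrightarrow>
      of_int u + of_int v * s > 0 \<and> of_int u - of_int v * s > 0" for u v :: int
    using totally_positive_iff[of "of_int u / 2" "of_int v / 2"]
    by (simp add: of_rat_divide add_divide_distrib[symmetric] diff_divide_distrib[symmetric])
  then show ?thesis
    unfolding totally_positive_integers_def ring_of_integers_iff mem_Collect_eq by blast
qed

lemma sum_of_squares_coordinates:
  assumes "set xs \<subseteq> ring_of_integers (quad_field D)"
  shows "\<exists>L :: (int \<times> int) list. (\<forall>(p, q)\<in>set L. integer_parity p q) \<and>
     4 * (\<Sum>y\<leftarrow>xs. y\<^sup>2) = of_int (\<Sum>(p, q)\<leftarrow>L. p\<^sup>2 + D * q\<^sup>2) + of_int (2 * (\<Sum>(p, q)\<leftarrow>L. p * q)) * s"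
  using assms
proof (induction xs)
  case Nil
  show ?case by (intro exI[of _ "[]"]) simp
next
  case (Cons y xs)
  then obtain L :: "(int \<times> int) list" where L: "\<forall>(p, q)\<in>set L. integer_parity p q"
     "4 * (\<Sum>y\<leftarrow>xs. y\<^sup>2) = of_int (\<Sum>(p, q)\<leftarrow>L. p\<^sup>2 + D * q\<^sup>2) + of_int (2 * (\<Sum>(p, q)\<leftarrow>L. p * q)) * s"
    by auto
  from Cons.prems obtain p q :: int where y: "y = (of_int p + of_int q * s) / 2" "integer_parity p q"
    by (auto simp: ring_of_integers_iff)
  have "4 * y\<^sup>2 = of_int (p\<^sup>2 + D * q\<^sup>2) + of_int (2 * (p * q)) * s"
    unfolding y(1) by (simp add: power2_eq_square field_simps flip: s_sq)
  then show ?case using L y(2)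
    by (intro exI[of _ "(p, q) # L"]) (auto simp: algebra_simps)
qed

lemma sum_of_five_squares:
  fixes A B C :: int
  assumes "A \<ge> 0" "C \<ge> 0" "B\<^sup>2 \<le> A * C"
    and w: "\<And>p q :: int. of_int p + of_int q * w \<in> ring_of_integers (quad_field D)"
  shows "sum_of_n_squares (ring_of_integers (quad_field D)) 5 (of_int A + 2 * of_int B * w + of_int C * w\<^sup>2)"
proof -
  obtain L :: "(int \<times> int) list" where L: "length L = 5" "A = (\<Sum>(u, v)\<leftarrow>L. u\<^sup>2)"
    "B = (\<Sum>(u, v)\<leftarrow>L. u * v)" "C = (\<Sum>(u, v)\<leftarrow>L. v\<^sup>2)"
    using five_squares_binary[OF assms(1-3)] by blast
  have "of_int (\<Sum>(u, v)\<leftarrow>L. u\<^sup>2) + 2 * of_int (\<Sum>(u, v)\<leftarrow>L. u * v) * w + of_int (\<Sum>(u, v)\<leftarrow>L. v\<^sup>2) * w\<^sup>2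
      = (\<Sum>y\<leftarrow>map (\<lambda>(u, v). of_int u + of_int v * w) L. y\<^sup>2)"
    by (induction L) (auto simp: power2_eq_square algebra_simps)
  then show ?thesis unfolding sum_of_n_squares_def L(2-4)
    using L(1) w by (intro exI[of _ "map (\<lambda>(u, v). of_int u + of_int v * w) L"]) auto
qed

lemma pos_iff:
  fixes u v :: int
  assumes "of_int u + of_int v * s > 0" "of_int u - of_int v * s > 0"
  shows "u > 0" "D * v\<^sup>2 < u\<^sup>2"
proof -
  have "of_int u > (0 :: real)" using assms by linarith
  then show "u > 0" by simp
  have "0 < (of_int u + of_int v * s) * (of_int u - of_int v * s)" using assms by (rule mult_pos_pos)
  also have "\<dots> = of_int u * of_int u - (s * s) * (of_int v * of_int v)" by (simp add: algebra_simps)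
  also have "\<dots> = of_int (u\<^sup>2 - D * v\<^sup>2)" unfolding s_sq by (simp add: power2_eq_square)
  finally show "D * v\<^sup>2 < u\<^sup>2" by (simp only: of_int_0_less_iff)
qed

section \<open>Multiples that are and are not sums of squares\<close>

text \<open>Take \<open>\<alpha> = (u + \<delta> s) / 2\<close> with \<open>u\<close> the least integer above \<open>\<delta> s\<close> of the right parity,
  where \<open>\<delta> = \<kappa>\<close>. In a representation of \<open>m \<alpha>\<close> some \<open>p q\<close> is nonzero, and then \<open>|p|\<close> and \<open>|q|\<close>
  are at least \<open>\<delta>\<close> by parity, so that \<open>\<delta>^2 (1 + D) \<le> 2 m u \<le> 2 m (\<delta> s + 2)\<close>. For \<open>m < \<delta> s / 4\<close>
  the right-hand side is less than \<open>\<delta>^2 D / 2 + \<delta> s\<close>, and \<open>(\<delta> s - 1)^2 \<ge> 0\<close> gives a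
  contradiction.\<close>
lemma small_multiple_not_sum_of_squares:
  assumes m: "real m < real (kappa D) * s / 4" "m > 0"
  shows "\<exists>x\<in>dilate m (totally_positive_integers (quad_field D)). \<not> sum_of_squares (ring_of_integers (quad_field D)) x"
proof -
  define \<delta> :: int where "\<delta> = (if D mod 4 = 1 then 1 else 2)"
  obtain u :: int where u: "integer_parity u \<delta>" "\<delta> * s < u" "u \<le> \<delta> * s + 2"
  proof (cases "D mod 4 = 1")
    case True
    define f where "f = \<lfloor>s\<rfloor>"
    have f: "of_int f \<le> s" "s < of_int f + 1" by (auto simp: f_def)
    show ?thesis
    proof (rule that[of "if odd f then f + 2 else f + 1"])
      show "integer_parity (if odd f then f + 2 else f + 1) \<delta>" using True by (auto simp: integer_parity_def \<delta>_def)
    qed (use f True in \<open>auto simp: \<delta>_def\<close>)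
  next
    case False
    define f where "f = \<lfloor>s\<rfloor>"
    have f: "of_int f \<le> s" "s < of_int f + 1" by (auto simp: f_def)
    show ?thesis
      by (rule that[of "2 * (f + 1)"]) (use f False in \<open>auto simp: \<delta>_def integer_parity_def\<close>)
  qed
  have \<delta>: "\<delta> = 1 \<or> \<delta> = 2" by (auto simp: \<delta>_def)
  define \<alpha> where "\<alpha> = (of_int u + of_int \<delta> * s) / 2"
  have "0 < \<delta> * s" using \<delta> s_pos by auto
  then have "\<alpha> \<in> totally_positive_integers (quad_field D)"
    unfolding totally_positive_integers_iff \<alpha>_def using u by (intro exI[of _ u] exI[of _ \<delta>]) auto
  moreover have "\<not> sum_of_squares (ring_of_integers (quad_field D)) (of_nat m * \<alpha>)"
  proof
    assume "sum_of_squares (ring_of_integers (quad_field D)) (of_nat m * \<alpha>)"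
    then obtain xs where xs: "set xs \<subseteq> ring_of_integers (quad_field D)" "of_nat m * \<alpha> = (\<Sum>y\<leftarrow>xs. y\<^sup>2)"
      by (auto simp: sum_of_squares_def sum_of_n_squares_def)
    obtain L :: "(int \<times> int) list" where L: "\<forall>(p, q)\<in>set L. integer_parity p q"
      "4 * (\<Sum>y\<leftarrow>xs. y\<^sup>2) = of_int (\<Sum>(p, q)\<leftarrow>L. p\<^sup>2 + D * q\<^sup>2) + of_int (2 * (\<Sum>(p, q)\<leftarrow>L. p * q)) * s"
      using sum_of_squares_coordinates[OF xs(1)] by blast
    have "4 * (of_nat m * \<alpha>) = of_int (2 * int m * u) + of_int (2 * int m * \<delta>) * s"
      by (simp add: \<alpha>_def algebra_simps)
    then have "of_int (\<Sum>(p, q)\<leftarrow>L. p\<^sup>2 + D * q\<^sup>2) + of_int (2 * (\<Sum>(p, q)\<leftarrow>L. p * q)) * s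
       = of_int (2 * int m * u) + of_int (2 * int m * \<delta>) * s" using L(2) xs(2) by simp
    from int_coordinates_unique[OF this]
    have tr: "(\<Sum>(p, q)\<leftarrow>L. p\<^sup>2 + D * q\<^sup>2) = 2 * int m * u" and cr: "(\<Sum>(p, q)\<leftarrow>L. p * q) = int m * \<delta>" by auto
    have "(\<Sum>(p, q)\<leftarrow>L. p * q) \<noteq> 0" unfolding cr using \<delta> m by auto
    then obtain p q where pq: "(p, q) \<in> set L" "p * q \<noteq> 0"
      by (induction L) fastforce+
    have "\<delta>\<^sup>2 * (1 + D) \<le> p\<^sup>2 + D * q\<^sup>2"
    proof -
      have par: "integer_parity p q" using L(1) pq by auto
      have "\<delta> \<le> \<bar>p\<bar>" "\<delta> \<le> \<bar>q\<bar>"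
        using par pq(2) by (auto simp: \<delta>_def integer_parity_def dest: dvd_imp_le_int split: if_splits)
      then have "\<delta>\<^sup>2 \<le> p\<^sup>2" "\<delta>\<^sup>2 \<le> q\<^sup>2" using \<delta> by (auto intro!: abs_le_square_iff[THEN iffD1])
      then have "\<delta>\<^sup>2 + D * \<delta>\<^sup>2 \<le> p\<^sup>2 + D * q\<^sup>2" using D by (intro add_mono mult_left_mono) auto
      then show ?thesis by (simp add: algebra_simps)
    qed
    also have "p\<^sup>2 + D * q\<^sup>2 \<le> (\<Sum>(p, q)\<leftarrow>L. p\<^sup>2 + D * q\<^sup>2)"
    proof -
      have nn: "0 \<le> (\<Sum>(p, q)\<leftarrow>L'. p\<^sup>2 + D * q\<^sup>2)" for L'
        using D by (intro sum_list_nonneg) auto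
      show ?thesis using pq(1)
      proof (induction L)
        case (Cons a L)
        have "0 \<le> (case a of (p, q) \<Rightarrow> p\<^sup>2 + D * q\<^sup>2)" using D by (cases a) auto
        then show ?case using Cons nn[of L] by auto
      qed simp
    qed
    also have "\<dots> = 2 * int m * u" by (rule tr)
    finally have "of_int (\<delta>\<^sup>2 * (1 + D)) \<le> (of_int (2 * int m * u) :: real)" by (simp only: of_int_le_iff)
    then have lower: "of_int \<delta> ^ 2 * (1 + s * s) \<le> 2 * of_nat m * of_int u" by (simp add: s_sq)
    have "real (kappa D) = of_int \<delta>" by (simp add: kappa_def \<delta>_def)
    then have "2 * real m < of_int \<delta> * s / 2" using m by simp
    moreover have "0 < (of_int u :: real)" using u(2) \<open>0 < \<delta> * s\<close> by linarith
    ultimately have "2 * real m * of_int u < (of_int \<delta> * s / 2) * of_int u"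
      by (intro mult_strict_right_mono)
    also have "\<dots> \<le> (of_int \<delta> * s / 2) * (\<delta> * s + 2)"
      using u(3) \<open>0 < \<delta> * s\<close> by (intro mult_left_mono) auto
    also have "\<dots> = (of_int \<delta> * s)\<^sup>2 / 2 + of_int \<delta> * s" by (simp add: power2_eq_square algebra_simps)
    also have "\<dots> \<le> (of_int \<delta>)\<^sup>2 * (1 + s * s)"
    proof -
      have "0 \<le> (of_int \<delta> * s - 1)\<^sup>2" by simp
      moreover have "1 \<le> (of_int \<delta> :: real)\<^sup>2" using \<delta> by auto
      ultimately show ?thesis by (simp add: power2_eq_square algebra_simps)
    qed
    finally show False using lower by simp
  qed
  ultimately show ?thesis by (auto simp: dilate_def)
qed

lemma odd_multiple_not_sum_of_squares:
  assumes m: "odd m" and D4: "D mod 4 \<noteq> 1"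
  shows "\<exists>x\<in>dilate m (totally_positive_integers (quad_field D)). \<not> sum_of_squares (ring_of_integers (quad_field D)) x"
proof -
  define \<alpha> where "\<alpha> = (of_int (2 * D) + of_int 2 * s) / 2"
  have "s < of_int D"
  proof -
    have "s * 1 < s * s" using s_pos D by (intro mult_strict_left_mono) (auto simp: s_def real_less_rsqrt)
    then show ?thesis by (simp add: s_sq)
  qed
  then have "\<alpha> \<in> totally_positive_integers (quad_field D)"
    unfolding totally_positive_integers_iff \<alpha>_def using s_pos D4
    by (intro exI[of _ "2 * D"] exI[of _ 2]) (auto simp: integer_parity_def)
  moreover have "\<not> sum_of_squares (ring_of_integers (quad_field D)) (of_nat m * \<alpha>)"
  proof
    assume "sum_of_squares (ring_of_integers (quad_field D)) (of_nat m * \<alpha>)"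
    then obtain xs where xs: "set xs \<subseteq> ring_of_integers (quad_field D)" "of_nat m * \<alpha> = (\<Sum>y\<leftarrow>xs. y\<^sup>2)"
      by (auto simp: sum_of_squares_def sum_of_n_squares_def)
    obtain L :: "(int \<times> int) list" where L: "\<forall>(p, q)\<in>set L. integer_parity p q"
      "4 * (\<Sum>y\<leftarrow>xs. y\<^sup>2) = of_int (\<Sum>(p, q)\<leftarrow>L. p\<^sup>2 + D * q\<^sup>2) + of_int (2 * (\<Sum>(p, q)\<leftarrow>L. p * q)) * s"
      using sum_of_squares_coordinates[OF xs(1)] by blast
    have "4 * (of_nat m * \<alpha>) = of_int (4 * int m * D) + of_int (4 * int m) * s"
      by (simp add: \<alpha>_def algebra_simps)
    then have "of_int (\<Sum>(p, q)\<leftarrow>L. p\<^sup>2 + D * q\<^sup>2) + of_int (2 * (\<Sum>(p, q)\<leftarrow>L. p * q)) * s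
       = of_int (4 * int m * D) + of_int (4 * int m) * s" using L(2) xs(2) by simp
    from int_coordinates_unique(2)[OF this] have "(\<Sum>(p, q)\<leftarrow>L. p * q) = 2 * int m" by simp
    moreover have "4 dvd (\<Sum>(p, q)\<leftarrow>L. p * q)"
      using L(1)
    proof (induction L)
      case (Cons a L)
      obtain p q where a: "a = (p, q)" by (cases a)
      have "even p" "even q" using Cons.prems D4 by (auto simp: a integer_parity_def)
      then have "2 * 2 dvd p * q" by (rule mult_dvd_mono)
      then show ?case using Cons by (simp add: a)
    qed simp
    ultimately have "even (int m)" by presburger
    then show False using m by simp
  qed
  ultimately show ?thesis by (auto simp: dilate_def)
qed

text \<open>Matching the two coordinates of \<open>A + 2 B w + C w^2 = \<kappa> m \<alpha>\<close> leaves \<open>C\<close> free, up to a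
  parity condition if \<open>D = 1\<close> modulo 4. Let \<open>N \<ge> 1\<close> be the norm of \<open>\<alpha>\<close> and \<open>t / D\<close> the ideal
  value of \<open>C\<close>. Completing the square gives \<open>4 D (A C - B^2) = 4 m^2 N - (D C - t)^2\<close> if
  \<open>D = 1\<close> modulo 4, where \<open>|D C - t| \<le> D\<close> can be achieved under the parity condition, and
  \<open>D (A C - B^2) = m^2 N - (D C - t)^2\<close> otherwise, where \<open>|D C - t| \<le> D / 2\<close> can be achieved.
  In both cases \<open>2 m \<ge> D\<close> suffices.\<close>
lemma large_multiple_five_squares:
  assumes m: "of_int D / 2 \<le> real m" and x: "x \<in> dilate (kappa D * m) (totally_positive_integers (quad_field D))"
  shows "sum_of_n_squares (ring_of_integers (quad_field D)) 5 x"
proof -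
  from x obtain \<alpha> where \<alpha>: "x = of_nat (kappa D * m) * \<alpha>" "\<alpha> \<in> totally_positive_integers (quad_field D)"
    unfolding dilate_def by blast
  then obtain u v :: int where u: "\<alpha> = (of_int u + of_int v * s) / 2" and par: "integer_parity u v"
    and pos: "of_int u + of_int v * s > 0" "of_int u - of_int v * s > 0"
    unfolding totally_positive_integers_iff by blast
  have x: "x = of_nat (kappa D * m) * ((of_int u + of_int v * s) / 2)" unfolding \<alpha>(1) u ..
  note uv = pos_iff[OF pos]
  have "of_int D \<le> real (2 * m)" using m by simp
  then have "D \<le> int (2 * m)" by linarith
  then have Dm: "D\<^sup>2 \<le> (2 * int m)\<^sup>2" using D by (intro power_mono) auto
  have N4: "4 \<le> u\<^sup>2 - D * v\<^sup>2"
    using par uv(2) unfolding integer_parity_iff by (intro zdvd_imp_le) auto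
  have Dpos: "D > 0" using D by simp
  have mpos: "m > 0" using \<open>D \<le> int (2 * m)\<close> Dpos by simp
  show ?thesis
  proof (cases "D mod 4 = 1")
    case True
    define C1 where "C1 = (int m * u) div D"
    define C where "C = (if even (C1 - int m * v) then C1 else C1 + 1)"
    have C_par: "even (C - int m * v)" by (auto simp: C_def)
    have "int m * u = D * C1 + (int m * u) mod D" by (simp add: C1_def)
    moreover have "0 \<le> (int m * u) mod D" "(int m * u) mod D < D" using Dpos by auto
    ultimately have "\<bar>D * C - int m * u\<bar> \<le> \<bar>D\<bar>" by (auto simp: C_def algebra_simps)
    then have close: "(D * C - int m * u)\<^sup>2 \<le> D\<^sup>2" by (rule abs_le_square_iff[THEN iffD1])
    have "(D * C - int m * u)\<^sup>2 \<le> (int m)\<^sup>2 * (u\<^sup>2 - D * v\<^sup>2)"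
    proof -
      have "D\<^sup>2 \<le> (int m)\<^sup>2 * 4" using Dm by (simp add: power_mult_distrib)
      also have "\<dots> \<le> (int m)\<^sup>2 * (u\<^sup>2 - D * v\<^sup>2)" using N4 by (intro mult_left_mono) auto
      finally show ?thesis using close by simp
    qed
    moreover have "(int m)\<^sup>2 * (u\<^sup>2 - D * v\<^sup>2) - (D * C - int m * u)\<^sup>2 = 
        D * (2 * int m * u * C - D * C\<^sup>2 - (int m * v)\<^sup>2)"
      by (simp add: power2_eq_square algebra_simps)
    ultimately have "0 \<le> D * (2 * int m * u * C - D * C\<^sup>2 - (int m * v)\<^sup>2)" by linarith
    then have disc: "0 \<le> 2 * int m * u * C - D * C\<^sup>2 - (int m * v)\<^sup>2" using Dpos by (simp add: zero_le_mult_iff)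
    have "even (int m * v - C)" using C_par by (simp add: dvd_diff_commute)
    then obtain B where B: "int m * v - C = 2 * B" by (rule evenE)
    obtain D' where D': "D = 4 * D' + 1" using True by (metis mult_div_mod_eq)
    have "even (u - v)" using par True by (simp add: integer_parity_def)
    then obtain e where e: "u - v = 2 * e" by (rule evenE)
    define A where "A = int m * e - C * D'"
    have "4 * (A * C - B\<^sup>2) = 2 * int m * u * C - D * C\<^sup>2 - (int m * v)\<^sup>2"
    proof -
      have B2: "4 * B\<^sup>2 = (int m * v - C)\<^sup>2" unfolding B by (simp add: power_mult_distrib)
      have "4 * (A * C) = 2 * int m * (u - v) * C - (D - 1) * C\<^sup>2"
        unfolding e D' A_def by (simp add: power2_eq_square algebra_simps)
      then show ?thesis using B2 by (simp add: power2_eq_square algebra_simps)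
    qed
    then have "0 \<le> 4 * (A * C - B\<^sup>2)" using disc by (simp only:)
    then have ACB: "B\<^sup>2 \<le> A * C" by (simp add: zero_le_mult_iff)
    define w where "w = (1 + s) / 2"
    \<comment> \<open>For negative C the left-hand side of disc would be negative.\<close>
    have "C \<ge> 0"
    proof (rule ccontr)
      assume "\<not> C \<ge> 0"
      then have "int m * u * C \<le> 0" "D * C\<^sup>2 > 0" using uv(1) Dpos by (auto simp: mult_le_0_iff)
      then show False using disc zero_le_power2[of "int m * v"] by linarith
    qed
    have "A \<ge> 0"
    proof (cases "C = 0")
      case True
      then have "int m * v = 0" using disc by simp
      then have "v = 0" using mpos by simp
      then show ?thesis using True e uv(1) by (simp add: A_def)
    next
      case False
      with \<open>C \<ge> 0\<close> have "C > 0" by simp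
      moreover have "0 \<le> A * C" using ACB zero_le_power2[of B] by linarith
      ultimately show ?thesis by (simp add: zero_le_mult_iff)
    qed
    have "of_int p + of_int q * w \<in> ring_of_integers (quad_field D)" for p q :: int
      unfolding ring_of_integers_iff w_def integer_parity_def using True
      by (intro exI[of _ "2 * p + q"] exI[of _ q]) (auto simp: field_simps)
    from sum_of_five_squares[OF \<open>A \<ge> 0\<close> \<open>C \<ge> 0\<close> ACB this]
    have "sum_of_n_squares (ring_of_integers (quad_field D)) 5 (of_int A + 2 * of_int B * w + of_int C * w\<^sup>2)" .
    moreover have "of_int A + 2 * of_int B * w + of_int C * w\<^sup>2 = x"
    proof -
      have w2: "w\<^sup>2 = w + of_int D'"
      proof -
        have "s * s = 4 * of_int D' + 1" unfolding s_sq D' by simp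
        then show ?thesis by (simp add: w_def power2_eq_square field_simps)
      qed
      have B': "2 * of_int B = of_nat m * of_int v - (of_int C :: real)" 
        using arg_cong[OF B, of "of_int :: int \<Rightarrow> real"] by simp
      have e': "2 * of_int e = of_int u - (of_int v :: real)" 
        using arg_cong[OF e, of "of_int :: int \<Rightarrow> real"] by simp
      have "of_int A + 2 * of_int B * w + of_int C * w\<^sup>2 = of_nat m * (of_int e + of_int v * w)"
        unfolding w2 B' by (simp add: A_def algebra_simps)
      also have "\<dots> = of_nat m * ((2 * of_int e + of_int v + of_int v * s) / 2)"
        by (simp add: w_def field_simps)
      finally show ?thesis unfolding e' x using True by (simp add: kappa_def)
    qed
    ultimately show ?thesis by simp
  next
    case False
    obtain a b where ab: "u = 2 * a" "v = 2 * b" using par False unfolding integer_parity_def by (metis evenE)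
    have N1: "1 \<le> a\<^sup>2 - D * b\<^sup>2" using N4 by (simp add: ab power_mult_distrib)
    define C where "C = (2 * int m * a + D) div (2 * D)"
    have "2 * int m * a + D = 2 * D * C + (2 * int m * a + D) mod (2 * D)" by (simp add: C_def)
    moreover have "0 \<le> (2 * int m * a + D) mod (2 * D)" "(2 * int m * a + D) mod (2 * D) < 2 * D" using Dpos by auto
    ultimately have "\<bar>2 * (D * C - int m * a)\<bar> \<le> \<bar>D\<bar>" by auto
    then have close: "(2 * (D * C - int m * a))\<^sup>2 \<le> D\<^sup>2" by (rule abs_le_square_iff[THEN iffD1])
    have "4 * (D * C - int m * a)\<^sup>2 \<le> 4 * ((int m)\<^sup>2 * (a\<^sup>2 - D * b\<^sup>2))"
    proof -
      have "D\<^sup>2 \<le> 4 * ((int m)\<^sup>2 * 1)" using Dm by (simp add: power_mult_distrib)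
      also have "\<dots> \<le> 4 * ((int m)\<^sup>2 * (a\<^sup>2 - D * b\<^sup>2))" using N1 by (intro mult_left_mono) auto
      finally have "(2 * (D * C - int m * a))\<^sup>2 \<le> 4 * ((int m)\<^sup>2 * (a\<^sup>2 - D * b\<^sup>2))"
        using close by (rule order_trans[rotated])
      then show ?thesis unfolding power_mult_distrib[of 2] by simp
    qed
    moreover have "(int m)\<^sup>2 * (a\<^sup>2 - D * b\<^sup>2) - (D * C - int m * a)\<^sup>2 = 
        D * (2 * int m * a * C - D * C\<^sup>2 - (int m * b)\<^sup>2)"
      by (simp add: power2_eq_square algebra_simps)
    ultimately have "0 \<le> D * (2 * int m * a * C - D * C\<^sup>2 - (int m * b)\<^sup>2)" by linarith
    then have disc: "0 \<le> 2 * int m * a * C - D * C\<^sup>2 - (int m * b)\<^sup>2" using Dpos by (simp add: zero_le_mult_iff)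
    define A where "A = 2 * int m * a - C * D"
    have ACB: "(int m * b)\<^sup>2 \<le> A * C" using disc by (simp add: A_def power2_eq_square algebra_simps)
    have "a > 0" using uv(1) ab by simp
    have "C \<ge> 0"
    proof (rule ccontr)
      assume "\<not> C \<ge> 0"
      then have "int m * a * C \<le> 0" "D * C\<^sup>2 > 0" using \<open>a > 0\<close> Dpos by (auto simp: mult_le_0_iff)
      then show False using disc zero_le_power2[of "int m * b"] by linarith
    qed
    have "A \<ge> 0"
    proof (cases "C = 0")
      case True
      then show ?thesis using \<open>a > 0\<close> by (simp add: A_def)
    next
      case False
      with \<open>C \<ge> 0\<close> have "C > 0" by simp
      moreover have "0 \<le> A * C" using ACB zero_le_power2[of "int m * b"] by linarith
      ultimately show ?thesis by (simp add: zero_le_mult_iff)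
    qed
    have "of_int p + of_int q * s \<in> ring_of_integers (quad_field D)" for p q :: int
      unfolding ring_of_integers_iff integer_parity_def using False
      by (intro exI[of _ "2 * p"] exI[of _ "2 * q"]) (auto simp: field_simps)
    from sum_of_five_squares[OF \<open>A \<ge> 0\<close> \<open>C \<ge> 0\<close> ACB this]
    have "sum_of_n_squares (ring_of_integers (quad_field D)) 5 (of_int A + 2 * of_int (int m * b) * s + of_int C * s\<^sup>2)" .
    moreover have "of_int A + 2 * of_int (int m * b) * s + of_int C * s\<^sup>2 = x"
      unfolding power2_eq_square s_sq x A_def ab using False by (simp add: kappa_def algebra_simps)
    ultimately show ?thesis by simp
  qed
qed

end

theorem theorem4:
  fixes D :: int and m :: nat and K \<O> \<O>p :: "real set"
  assumes "D \<ge> 2" and "squarefree D" and "m > 0"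
  defines "K \<equiv> quad_field D"
  defines "\<O> \<equiv> ring_of_integers K"
  defines "\<O>p \<equiv> totally_positive_integers K"
  shows "(real m < real (kappa D) * sqrt (of_int D) / 4 \<longrightarrow>
           \<not> (\<forall>x \<in> dilate m \<O>p. sum_of_squares \<O> x))
       \<and> (real m \<ge> of_int D / 2 \<longrightarrow>
           (\<forall>x \<in> dilate (kappa D * m) \<O>p. sum_of_n_squares \<O> 5 x))
       \<and> (odd m \<and> (D mod 4 = 2 \<or> D mod 4 = 3) \<longrightarrow>
           (\<exists>x \<in> dilate m \<O>p. \<not> sum_of_squares \<O> x))"
proof -
  interpret real_quadratic D "sqrt (of_int D)"
    using assms(1,2) by unfold_locales auto
  show ?thesis
    unfolding K_def \<O>_def \<O>p_def
    using small_multiple_not_sum_of_squares[of m] large_multiple_five_squares[of m]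
      odd_multiple_not_sum_of_squares[of m] assms(3)
    by (intro conjI impI) auto
qed

end
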